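(* There is an absolute constant $c>0$ such that for every integer $n\ge 2$ there exists a graph $G$ on $n$ vertices with obstacle number ${\rm obs}(G)\ge c\, n/\log n$.
   Context: An obstacle representation of a graph $G$ consists of a set $P$ of points in the plane, one for each vertex of $G$, together with a set of closed polygonal obstacles (connected polygonal regions) such that the points of $P$ and the vertices of the obstacles are in general position (no three on a line), and such that two vertices of $G$ are adjacent if and only if the segment connecting the corresponding points does not meet any obstacle. The obstacle number ${\rm obs}(G)$ is the minimum number of obstacles in an obstacle representation of $G$. *)

theory Defs
  imports "HOL-Analysis.Analysis"
begin

definition simple_graph :: "'a set \<Rightarrow> 'a set set \<Rightarrow> bool" where
  "simple_graph V E \<longleftrightarrow> finite V \<and> (\<forall>e\<in>E. e \<subseteq> V \<and> card e = 2)"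

text \<open>Holes, and parts that touch only at a point, are allowed.\<close>

definition polygonal_region :: "(real^2) set \<Rightarrow> bool" where
  "polygonal_region R \<longleftrightarrow> R \<noteq> {} \<and> connected R \<and>
     (\<exists>F. finite F \<and> (\<forall>T\<in>F. polytope T \<and> interior T \<noteq> {}) \<and> R = \<Union>F)"

text \<open>
  The vertices of a polygonal region are the boundary points near which the region is not a
  half-plane, i.e. those not in the relative interior of a side.
\<close>

definition region_vertices :: "(real^2) set \<Rightarrow> (real^2) set" where
  "region_vertices R = {v \<in> frontier R.
     \<not> (\<exists>a e. a \<noteq> 0 \<and> e > 0 \<and> R \<inter> ball v e = {x. a \<bullet> x \<le> a \<bullet> v} \<inter> ball v e)}"

definition general_position :: "(real^2) set \<Rightarrow> bool" where
  "general_position S \<longleftrightarrow>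
     (\<forall>a\<in>S. \<forall>b\<in>S. \<forall>c\<in>S. a \<noteq> b \<and> b \<noteq> c \<and> a \<noteq> c \<longrightarrow> \<not> collinear {a, b, c})"

definition obstacle_representation ::
    "'a set \<Rightarrow> 'a set set \<Rightarrow> ('a \<Rightarrow> real^2) \<Rightarrow> (real^2) set set \<Rightarrow> bool" where
  "obstacle_representation V E p Obs \<longleftrightarrow>
     inj_on p V \<and> finite Obs \<and> (\<forall>R\<in>Obs. polygonal_region R) \<and>
     general_position (p ` V \<union> (\<Union>R\<in>Obs. region_vertices R)) \<and>
     (\<forall>u\<in>V. \<forall>v\<in>V. u \<noteq> v \<longrightarrow>
        ({u, v} \<in> E \<longleftrightarrow> (\<forall>R\<in>Obs. closed_segment (p u) (p v) \<inter> R = {})))"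

text \<open>
  On the natural numbers the infimum of a nonempty set is its minimum, and the infimum of the
  empty set is 0, so a positive value can only come from an actual representation.
\<close>

definition obstacle_number :: "'a set \<Rightarrow> 'a set set \<Rightarrow> nat" where
  "obstacle_number V E = Inf {card Obs | p Obs. obstacle_representation V E p Obs}"

end

theory Submission
  imports Defs "HOL-Library.Ramsey" "HOL-Library.Nat_Bijection"
begin

text \<open>
  If the sides of some triangles are edges of the graph and the union of these triangles
  contains a non-edge, then an obstacle blocking this non-edge is connected and cannot
  cross the boundary of the union, so it lies in the convex hull of the points involved.

  Some fixed graph forces this in every drawing: take a large clique \<open>A\<close> and, for every
  \<open>X \<subseteq> A\<close>, a vertex \<open>b\<close> whose neighbours in \<open>A\<close> are exactly \<open>X\<close>. By Ramsey's theorem for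
  orientations of triples, \<open>A\<close> contains a convex hexagon; let \<open>X\<close> be every other corner of it. If
  \<open>b\<close> is in the hexagon, its non-edges are covered by triangles of the clique. Otherwise, as seen from
  \<open>b\<close>, some corner \<open>y \<notin> X\<close> lies between two corners \<open>x, x' \<in> X\<close>, and the non-edge \<open>b y\<close> is
  covered by the triangles \<open>b x x'\<close> and \<open>x x' y\<close>.

  A random graph on \<open>n\<close> vertices contains this pattern inside every sequence of \<open>k = O(log n)\<close>
  vertices, since a sequence has of order \<open>k\<^sup>2\<close> pairwise edge-disjoint places for it. Cutting the points
  of a representation by parallel lines into blocks of size \<open>k\<close> thus yields \<open>n div k\<close> distinct
  obstacles. As the infimum of the empty set is 0, it also matters that every graph has
  a representation: a tiny generic triangle on each non-edge.
\<close>

subsection \<open>Orientations and convex position\<close>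

text \<open>Twice the signed area of the triangle \<open>a b c\<close>.\<close>

definition orient :: "real^2 \<Rightarrow> real^2 \<Rightarrow> real^2 \<Rightarrow> real" where
  "orient a b c = (b$1 - a$1) * (c$2 - a$2) - (b$2 - a$2) * (c$1 - a$1)"

lemma inner_real2: "(x::real^2) \<bullet> y = x$1 * y$1 + x$2 * y$2"
  by (simp add: inner_vec_def sum_2)

lemma orient_rotate: "orient a b c = orient b c a"
  by (simp add: orient_def algebra_simps)

text \<open>Four points of the plane satisfy an affine dependence whose coefficients are, up to
  sign, the signed areas of the triangles omitting one of them. Here the affine functional
  \<open>u \<bullet> x - t\<close> is applied to it. When all four areas have one sign, it balances
  one diagonal against the other.\<close>

lemma affine_dependency_orient:
  "orient b c d * (u \<bullet> a - t) + orient a b d * (u \<bullet> c - t)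
     = orient a c d * (u \<bullet> b - t) + orient a b c * (u \<bullet> d - t)"
  by (simp add: orient_def inner_real2 algebra_simps)

lemma orient_zero_collinear:
  assumes "orient a b c = 0"
  shows "collinear {a, b, c}"
proof (cases "a = b")
  case False
  define w where "w = b - a"
  have w: "w$1 \<noteq> 0 \<or> w$2 \<noteq> 0"
    using False by (auto simp: w_def vec_eq_iff forall_2)
  have eq: "w$1 * (c$2 - a$2) = w$2 * (c$1 - a$1)"
    using assms by (simp add: orient_def w_def)
  obtain k where k: "c - a = k *\<^sub>R w"
  proof (cases "w$1 = 0")
    case True
    with w eq have "c - a = ((c$2 - a$2) / w$2) *\<^sub>R w"
      by (auto simp: vec_eq_iff forall_2)
    then show ?thesis by (rule that)
  next
    case False
    with eq have "c - a = ((c$1 - a$1) / w$1) *\<^sub>R w"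
      by (auto simp: vec_eq_iff forall_2 field_simps)
    then show ?thesis by (rule that)
  qed
  have "c = (1 - k) *\<^sub>R a + k *\<^sub>R b"
    using k by (simp add: w_def algebra_simps)
  then have "c \<in> affine hull {a, b}"
    unfolding affine_hull_2 by (smt (verit) mem_Collect_eq)
  then show ?thesis
    using False by (simp add: collinear_3_affine_hull)
qed simp

text \<open>Only the sign of \<sigma> matters; it treats clockwise and counterclockwise order at
  once.\<close>

definition same_orientation :: "nat set \<Rightarrow> (nat \<Rightarrow> real^2) \<Rightarrow> bool" where
  "same_orientation H q \<longleftrightarrow>
     (\<exists>\<sigma>. \<forall>i\<in>H. \<forall>j\<in>H. \<forall>k\<in>H. i < j \<and> j < k \<longrightarrow> \<sigma> * orient (q i) (q j) (q k) > (0::real))"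

text \<open>
  Four points all of whose triples are equally oriented are in convex position in this cyclic
  order, so no line separates one diagonal from the other.
\<close>

lemma diagonals_not_separated:
  assumes "same_orientation H q" "{i, j, k, l} \<subseteq> H" "i < j" "j < k" "k < l"
  shows "\<not> (u \<bullet> q i \<ge> t \<and> u \<bullet> q k \<ge> t \<and> u \<bullet> q j < t \<and> u \<bullet> q l < t)"
    and "\<not> (u \<bullet> q j \<ge> t \<and> u \<bullet> q l \<ge> t \<and> u \<bullet> q i < t \<and> u \<bullet> q k < t)"
proof -
  from assms(1) obtain \<sigma> where \<sigma>:
    "\<And>i j k. i \<in> H \<Longrightarrow> j \<in> H \<Longrightarrow> k \<in> H \<Longrightarrow> i < j \<Longrightarrow> j < k \<Longrightarrow> \<sigma> * orient (q i) (q j) (q k) > 0"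
    unfolding same_orientation_def by blast
  let ?A = "\<sigma> * orient (q j) (q k) (q l)" and ?B = "\<sigma> * orient (q i) (q j) (q l)"
  and ?C = "\<sigma> * orient (q i) (q k) (q l)" and ?D = "\<sigma> * orient (q i) (q j) (q k)"
  have pos: "?A > 0" "?B > 0" "?C > 0" "?D > 0"
    using assms by (auto intro!: \<sigma>)
  have eq: "?A * (u \<bullet> q i - t) + ?B * (u \<bullet> q k - t) = ?C * (u \<bullet> q j - t) + ?D * (u \<bullet> q l - t)"
    using arg_cong[OF affine_dependency_orient, of "\<lambda>x. \<sigma> * x"] by (simp add: distrib_left mult.assoc)
  show "\<not> (u \<bullet> q i \<ge> t \<and> u \<bullet> q k \<ge> t \<and> u \<bullet> q j < t \<and> u \<bullet> q l < t)"
  proof (rule notI, elim conjE)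
    assume h: "u \<bullet> q i \<ge> t" "u \<bullet> q k \<ge> t" "u \<bullet> q j < t" "u \<bullet> q l < t"
    have "?A * (u \<bullet> q i - t) \<ge> 0" "?B * (u \<bullet> q k - t) \<ge> 0"
      using h pos by auto
    moreover have "?C * (u \<bullet> q j - t) < 0" "?D * (u \<bullet> q l - t) < 0"
      using h pos by (auto intro: mult_pos_neg)
    ultimately show False using eq by linarith
  qed
  show "\<not> (u \<bullet> q j \<ge> t \<and> u \<bullet> q l \<ge> t \<and> u \<bullet> q i < t \<and> u \<bullet> q k < t)"
  proof (rule notI, elim conjE)
    assume h: "u \<bullet> q j \<ge> t" "u \<bullet> q l \<ge> t" "u \<bullet> q i < t" "u \<bullet> q k < t"
    have "?C * (u \<bullet> q j - t) \<ge> 0" "?D * (u \<bullet> q l - t) \<ge> 0"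
      using h pos by auto
    moreover have "?A * (u \<bullet> q i - t) < 0" "?B * (u \<bullet> q k - t) < 0"
      using h pos by (auto intro: mult_pos_neg)
    ultimately show False using eq by linarith
  qed
qed

section \<open>Segments seen from a point outside a convex hexagon\<close>

lemma orthogonal_coords_eq:
  fixes a u w :: "real^2"
  assumes "a \<noteq> 0" "a \<bullet> u = a \<bullet> w" "vector [- a$2, a$1] \<bullet> u = vector [- a$2, a$1] \<bullet> w"
  shows "u = w"
proof -
  define d where "d = u - w"
  have 1: "a$1 * d$1 + a$2 * d$2 = 0" and 2: "a$1 * d$2 = a$2 * d$1"
    using assms(2,3) by (simp_all add: inner_real2 d_def algebra_simps)
  have n: "a$1 * a$1 + a$2 * a$2 \<noteq> 0"
    using assms(1) by (simp add: vec_eq_iff forall_2 sum_squares_eq_zero_iff)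
  have "(a$1 * a$1 + a$2 * a$2) * d$1 = 0" "(a$1 * a$1 + a$2 * a$2) * d$2 = 0"
    using 1 2 by algebra+
  then have "d = 0" using n by (auto simp: vec_eq_iff forall_2)
  then show ?thesis by (simp add: d_def)
qed

text \<open>The hypotheses put \<open>y\<close> into the cone with apex \<open>b\<close> spanned by
  \<open>x\<close> and \<open>x'\<close>. If \<alpha> + \<beta> \<le> 1, then \<open>y\<close> lies
  in the first triangle. Otherwise the segment crosses the side from \<open>x\<close> to
  \<open>x'\<close> at parameter 1 / (\<alpha> + \<beta>), where the two coefficients add up to 1,
  and is split there.\<close>

lemma segment_subset_two_triangles:
  fixes b x x' y :: "'a::euclidean_space"
  assumes "y - b = \<alpha> *\<^sub>R (x - b) + \<beta> *\<^sub>R (x' - b)" "\<alpha> \<ge> 0" "\<beta> \<ge> 0"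
  shows "closed_segment b y \<subseteq> convex hull {b, x, x'} \<union> convex hull {x, x', y}"
proof (cases "\<alpha> + \<beta> \<le> 1")
  case True
  have "y = (1 - \<alpha> - \<beta>) *\<^sub>R b + \<alpha> *\<^sub>R x + \<beta> *\<^sub>R x'"
    using assms(1) by (simp add: algebra_simps)
  then have "y \<in> convex hull {b, x, x'}"
    unfolding convex_hull_3 using True assms(2,3)
    by (intro CollectI exI[of _ "1 - \<alpha> - \<beta>"] exI[of _ \<alpha>] exI[of _ \<beta>]) auto
  then have "closed_segment b y \<subseteq> convex hull {b, x, x'}"
    by (intro closed_segment_subset) (auto simp: hull_inc)
  then show ?thesis by blast
next
  case False
  define s where "s = \<alpha> + \<beta>"
  have s: "s > 1" using False by (simp add: s_def)
  define z where "z = b + (1/s) *\<^sub>R (y - b)"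
  have "z = (1 - (\<alpha>+\<beta>)/s) *\<^sub>R b + (\<alpha>/s) *\<^sub>R x + (\<beta>/s) *\<^sub>R x'"
    unfolding z_def assms(1) by (simp add: algebra_simps add_divide_distrib)
  then have zeq: "z = (\<alpha>/s) *\<^sub>R x + (\<beta>/s) *\<^sub>R x'" using s by (simp add: s_def)
  have "\<alpha>/s + \<beta>/s = 1" using s by (simp add: s_def add_divide_distrib[symmetric])
  then have "z \<in> convex hull {x, x'}"
    unfolding convex_hull_2 using zeq assms s by (smt (verit) divide_nonneg_pos mem_Collect_eq)
  then have z: "z \<in> convex hull {b, x, x'}" "z \<in> convex hull {x, x', y}"
    using hull_mono[of "{x,x'}" "{b,x,x'}" convex] hull_mono[of "{x,x'}" "{x,x',y}" convex] by blast+
  have zs: "z \<in> closed_segment b y"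
    unfolding in_segment using s by (intro exI[of _ "1/s"]) (auto simp: z_def algebra_simps)
  have "closed_segment b y \<subseteq> closed_segment b z \<union> closed_segment z y"
    using zs by (simp add: Un_closed_segment)
  moreover have "closed_segment b z \<subseteq> convex hull {b, x, x'}"
    using z by (intro closed_segment_subset) (auto simp: hull_inc)
  moreover have "closed_segment z y \<subseteq> convex hull {x, x', y}"
    using z by (intro closed_segment_subset) (auto simp: hull_inc)
  ultimately show ?thesis by blast
qed

text \<open>Project centrally from \<open>b\<close> to the line
  \<open>a \<bullet> (x - b) = 1\<close>; \<open>s\<close> is a coordinate of the image on that
  line. There the image of \<open>y\<close> is a convex combination of the other two images, and
  rescaling by the positive factors \<open>a \<bullet> (x - b)\<close> gives the cone
  coefficients.\<close>

lemma slope_between_imp_in_cone: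
  fixes a b :: "real^2"
  defines "s \<equiv> \<lambda>x. (vector [- a$2, a$1] \<bullet> (x - b)) / (a \<bullet> (x - b))"
  assumes "a \<bullet> (x - b) > 0" "a \<bullet> (x' - b) > 0" "a \<bullet> (y - b) > 0"
    and "s x \<le> s y" "s y \<le> s x'"
  obtains \<alpha> \<beta> where "y - b = \<alpha> *\<^sub>R (x - b) + \<beta> *\<^sub>R (x' - b)" "\<alpha> \<ge> 0" "\<beta> \<ge> 0"
proof -
  define g where "g = (\<lambda>x. a \<bullet> (x - b))"
  let ?c = "vector [- a$2, a$1] :: real^2"
  have g_eq: "a \<bullet> (z - b) = g z" for z by (simp add: g_def)
  have c: "?c \<bullet> (z - b) = s z * g z" if "g z > 0" for z
    using that by (simp add: s_def g_def)
  have g: "g x > 0" "g x' > 0" "g y > 0" using assms by (simp_all add: g_def)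
  have "s y \<in> closed_segment (s x) (s x')"
    using assms(5,6) by (simp add: closed_segment_eq_real_ivl)
  then obtain t where t: "0 \<le> t" "t \<le> 1" "s y = (1 - t) * s x + t * s x'"
    by (auto simp: in_segment)
  define \<alpha> where "\<alpha> = g y * (1 - t) / g x"
  define \<beta> where "\<beta> = g y * t / g x'"
  have "y - b = \<alpha> *\<^sub>R (x - b) + \<beta> *\<^sub>R (x' - b)"
  proof (rule orthogonal_coords_eq[of a])
    show "a \<noteq> 0" using assms(2) by auto
    show "a \<bullet> (y - b) = a \<bullet> (\<alpha> *\<^sub>R (x - b) + \<beta> *\<^sub>R (x' - b))"
      unfolding inner_add_right inner_scaleR_right g_eq
      using g by (simp add: \<alpha>_def \<beta>_def) (simp add: algebra_simps)
    show "?c \<bullet> (y - b) = ?c \<bullet> (\<alpha> *\<^sub>R (x - b) + \<beta> *\<^sub>R (x' - b))"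
      unfolding inner_add_right inner_scaleR_right
      using g by (simp add: c \<alpha>_def \<beta>_def t) (simp add: algebra_simps)
  qed
  moreover have "\<alpha> \<ge> 0" "\<beta> \<ge> 0" using g t by (auto simp: \<alpha>_def \<beta>_def)
  ultimately show ?thesis by (rule that)
qed

text \<open>A line separates \<open>b\<close> from the hexagon, so the corners can be compared by
  their slope \<open>s\<close> as seen from \<open>b\<close>. If no odd corner had a slope between
  those of two even corners, then two odd corners would lie beyond all even ones on the same side,
  and a line would separate two crossing diagonals.\<close>

lemma alternating_hexagon_covered:
  fixes b :: "real^2" and h :: "nat \<Rightarrow> nat"
  assumes "same_orientation H q" and hH: "\<And>i. i < 6 \<Longrightarrow> h i \<in> H" and mono: "strict_mono_on {..<6} h"
    and b: "b \<notin> convex hull (q ` H)" and "finite H"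
  obtains x x' y where "x \<in> {h 0, h 2, h 4}" "x' \<in> {h 0, h 2, h 4}" "y \<in> {h 1, h 3, h 5}"
    "closed_segment b (q y) \<subseteq> convex hull {b, q x, q x'} \<union> convex hull {q x, q x', q y}"
proof -
  note goal = that
  have "closed (convex hull (q ` H))"
    using \<open>finite H\<close> by (simp add: finite_imp_compact compact_convex_hull compact_imp_closed)
  then obtain a t where at: "a \<bullet> b < t" "\<And>x. x \<in> convex hull (q ` H) \<Longrightarrow> a \<bullet> x > t"
    using separating_hyperplane_closed_point[OF convex_convex_hull _ b] by blast
  let ?c = "vector [- a$2, a$1] :: real^2"
  define s where "s = (\<lambda>x. (?c \<bullet> (x - b)) / (a \<bullet> (x - b)))"
  have g: "a \<bullet> (q i - b) > 0" if "i \<in> H" for i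
    using at(1) at(2)[of "q i"] that by (auto simp: hull_inc inner_diff_right)
  \<comment> \<open>Comparing the slope with \<open>m\<close> amounts to asking for a side of a line
    through \<open>b\<close>, which makes \<open>diagonals_not_separated\<close> applicable to slope
    thresholds.\<close>
  have sless: "s (q i) < m \<longleftrightarrow> (?c - m *\<^sub>R a) \<bullet> q i < (?c - m *\<^sub>R a) \<bullet> b" if "i \<in> H" for i m
    using g[OF that] by (simp add: s_def field_simps inner_diff_right inner_diff_left)
  have lt: "h i < h j" if "i < j" "j < 6" for i j
    using mono that by (auto simp: strict_mono_on_def)
  have cross: "\<not> (s (q (h i)) \<ge> m \<and> s (q (h k)) \<ge> m \<and> s (q (h j)) < m \<and> s (q (h l)) < m)"
    "\<not> (s (q (h j)) \<ge> m \<and> s (q (h l)) \<ge> m \<and> s (q (h i)) < m \<and> s (q (h k)) < m)"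
    if "i < j" "j < k" "k < l" "l < 6" for i j k l m
    using diagonals_not_separated[OF assms(1), of "h i" "h j" "h k" "h l" "(?c - m *\<^sub>R a) \<bullet> b" "?c - m *\<^sub>R a"]
      that hH lt by (simp_all add: sless not_less[symmetric])
  have cone: thesis if xy: "x \<in> {h 0, h 2, h 4}" "x' \<in> {h 0, h 2, h 4}" "y \<in> {h 1, h 3, h 5}"
    "s (q x) \<le> s (q y)" "s (q y) \<le> s (q x')" for x x' y
  proof -
    have H: "x \<in> H" "x' \<in> H" "y \<in> H" using xy hH by auto
    obtain \<alpha> \<beta> where "q y - b = \<alpha> *\<^sub>R (q x - b) + \<beta> *\<^sub>R (q x' - b)" "\<alpha> \<ge> 0" "\<beta> \<ge> 0"
      using slope_between_imp_in_cone[of a "q x" b "q x'" "q y"] g H xy(4,5) unfolding s_def by blast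
    from segment_subset_two_triangles[OF this] show thesis
      using goal[OF xy(1-3)] by blast
  qed
  define lo where "lo = Min {s (q (h 0)), s (q (h 2)), s (q (h 4))}"
  define hi where "hi = Max {s (q (h 0)), s (q (h 2)), s (q (h 4))}"
  have lo: "s (q (h 0)) \<ge> lo" "s (q (h 2)) \<ge> lo" "s (q (h 4)) \<ge> lo"
    by (simp_all add: lo_def)
  have hi: "s (q (h 0)) \<le> hi" "s (q (h 2)) \<le> hi" "s (q (h 4)) \<le> hi"
    by (simp_all add: hi_def)
  have "lo \<in> {s (q (h 0)), s (q (h 2)), s (q (h 4))}" unfolding lo_def by (rule Min_in) auto
  then obtain x where x: "x \<in> {h 0, h 2, h 4}" "s (q x) = lo" by auto
  have "hi \<in> {s (q (h 0)), s (q (h 2)), s (q (h 4))}" unfolding hi_def by (rule Max_in) auto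
  then obtain x' where x': "x' \<in> {h 0, h 2, h 4}" "s (q x') = hi" by auto
  show thesis
  proof (rule ccontr)
    assume "\<not> thesis"
    then have out: "s (q (h i)) < lo \<or> s (q (h i)) > hi" if "i \<in> {1,3,5}" for i
      using cone[OF x(1) x'(1), of "h i"] x x' that by force
    \<comment> \<open>Any two odd corners interleave with two even ones, so the two pairs are
      crossing diagonals.\<close>
    have c1: "\<not> (s (q (h 1)) < lo \<and> s (q (h 3)) < lo)" "\<not> (s (q (h 3)) < lo \<and> s (q (h 5)) < lo)"
      "\<not> (s (q (h 1)) < lo \<and> s (q (h 5)) < lo)"
      using cross(1)[of 0 1 2 3 lo] cross(1)[of 2 3 4 5 lo] cross(1)[of 0 1 2 5 lo] lo by auto
    have c2: "\<not> (s (q (h i)) > hi \<and> s (q (h j)) > hi)" 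
      if "(i,j) \<in> {(1,3),(3,5),(1,5)}" for i j
    proof
      assume ij: "s (q (h i)) > hi \<and> s (q (h j)) > hi"
      \<comment> \<open>\<open>cross\<close> needs the upper pair weakly above and the lower pair
        strictly below one threshold. The threshold \<open>hi\<close> would leave the even corners
        only weakly below, so the smaller odd slope is taken.\<close>
      define m where "m = min (s (q (h i))) (s (q (h j)))"
      have "m > hi" "s (q (h i)) \<ge> m" "s (q (h j)) \<ge> m" using ij by (auto simp: m_def)
      then show False
        using cross(2)[of 0 1 2 3 m] cross(2)[of 2 3 4 5 m] cross(2)[of 0 1 2 5 m] hi that by auto
    qed
    \<comment> \<open>Three odd corners are distributed over two sides, so two of them share a
      side.\<close>
    show False
      using out[of 1] out[of 3] out[of 5] c1 c2[of 1 3] c2[of 3 5] c2[of 1 5] by auto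
  qed
qed

subsection \<open>A pattern that encloses an obstacle in every drawing\<close>

lemma general_position_subset: "general_position S \<Longrightarrow> S' \<subseteq> S \<Longrightarrow> general_position S'"
  unfolding general_position_def by (meson subsetD)

lemma frontier_convex_hull_triple_subset:
  fixes q :: "'b \<Rightarrow> real^2"
  assumes "card T = 2 \<or> card T = 3"
  shows "frontier (convex hull (q ` T)) \<subseteq> (\<Union>i\<in>T. \<Union>j\<in>T - {i}. closed_segment (q i) (q j))"
proof (cases "card T = 2")
  case True
  then obtain i j where ij: "T = {i, j}" "i \<noteq> j" by (auto simp: card_2_iff)
  have "frontier (closed_segment (q i) (q j)) \<subseteq> closed_segment (q i) (q j)"
    by (simp add: frontier_subset_closed)
  then show ?thesis using ij by (auto simp: segment_convex_hull)
next
  case False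
  then have "card T = 3" using assms by simp
  then obtain i j k where ijk: "T = {i, j, k}" "i \<noteq> j" "i \<noteq> k" "j \<noteq> k" by (auto simp: card_3_iff)
  have "frontier (convex hull {q i, q j, q k}) =
      closed_segment (q i) (q j) \<union> closed_segment (q j) (q k) \<union> closed_segment (q k) (q i)"
    by (rule frontier_of_triangle) simp
  then show ?thesis using ijk by auto
qed

text \<open>The frontier of a finite union lies in the union of the frontiers, hence in the sides of
  the triangles. A connected set that meets the union and misses all these sides cannot leave
  it.\<close>

lemma connected_subset_cliques_union:
  fixes q :: "'b \<Rightarrow> real^2"
  assumes "finite \<T>" "\<And>T. T \<in> \<T> \<Longrightarrow> card T = 2 \<or> card T = 3"
    and "connected R" "R \<inter> (\<Union>T\<in>\<T>. convex hull (q ` T)) \<noteq> {}"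
    and "\<And>T i j. T \<in> \<T> \<Longrightarrow> i \<in> T \<Longrightarrow> j \<in> T \<Longrightarrow> i \<noteq> j \<Longrightarrow> closed_segment (q i) (q j) \<inter> R = {}"
  shows "R \<subseteq> (\<Union>T\<in>\<T>. convex hull (q ` T))"
proof (rule ccontr)
  let ?K = "\<Union>T\<in>\<T>. convex hull (q ` T)"
  assume "\<not> R \<subseteq> ?K"
  then have "R \<inter> frontier ?K \<noteq> {}"
    using assms(3,4) by (intro connected_Int_frontier) auto
  moreover have "frontier ?K \<subseteq> (\<Union>T\<in>\<T>. frontier (convex hull (q ` T)))"
    using frontier_Union_subset[of "(\<lambda>T. convex hull (q ` T)) ` \<T>"] assms(1) by simp
  ultimately obtain T z where "T \<in> \<T>" "z \<in> R" "z \<in> frontier (convex hull (q ` T))" by blast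
  moreover have "frontier (convex hull (q ` T)) \<subseteq> (\<Union>i\<in>T. \<Union>j\<in>T - {i}. closed_segment (q i) (q j))"
    using \<open>T \<in> \<T>\<close> assms(2) by (intro frontier_convex_hull_triple_subset)
  ultimately show False using assms(5) by blast
qed

text \<open>Caratheodory's theorem in the plane yields at most three points;
  \<open>card H \<ge> 3\<close> permits padding them to exactly three.\<close>

lemma convex_hull_subset_triples:
  fixes q :: "'b \<Rightarrow> real^2"
  assumes "finite H" "card H \<ge> 3"
  shows "convex hull (q ` H) \<subseteq> (\<Union>T\<in>{T. T \<subseteq> H \<and> card T = 3}. convex hull (q ` T))"
proof
  fix x assume "x \<in> convex hull (q ` H)"
  then obtain S where S: "S \<subseteq> q ` H" "card S \<le> 3" "x \<in> convex hull S"
    unfolding caratheodory[of "q ` H"] by auto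
  from S(1) obtain U where U: "U \<subseteq> H" "inj_on q U" "S = q ` U"
    by (auto simp: subset_image_inj)
  have "card U \<le> 3" using S(2) U by (simp add: card_image)
  then obtain T where T: "U \<subseteq> T" "T \<subseteq> H" "card T = 3"
    using exists_subset_between[of U 3 H] assms U by auto
  then have "x \<in> convex hull (q ` T)"
    using S(3) U hull_mono[of "q ` U" "q ` T" convex] by blast
  then show "x \<in> (\<Union>T\<in>{T. T \<subseteq> H \<and> card T = 3}. convex hull (q ` T))"
    using T by blast
qed

text \<open>Colour each triple by the sign of its orientation and take a homogeneous set for two
  colours.\<close>

lemma ramsey_same_orientation:
  obtains N :: nat where "\<And>q. inj_on q {..<N} \<Longrightarrow> general_position (q ` {..<N}) \<Longrightarrow>
    \<exists>H. H \<subseteq> {..<N} \<and> card H = l \<and> same_orientation H q"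
proof -
  obtain N :: nat where N: "partn_lst {..<N} [l, l] 3" using ramsey_full by blast
  show thesis
  proof (rule that)
    fix q :: "nat \<Rightarrow> real^2"
    assume inj: "inj_on q {..<N}" and gp: "general_position (q ` {..<N})"
    \<comment> \<open>Orientation depends on the order of the three points, so a set is coloured by
      its increasing enumeration.\<close>
    define f :: "nat set \<Rightarrow> nat" where
      "f T = (let xs = sorted_list_of_set T in if orient (q (xs!0)) (q (xs!1)) (q (xs!2)) > 0 then 0 else 1)" for T
    have "f \<in> nsets {..<N} 3 \<rightarrow> {..<2}" by (auto simp: f_def Let_def)
    moreover have "length [l, l] = 2" by simp
    ultimately obtain c H where "c < length [l, l]" and c: "H \<in> nsets {..<N} ([l, l] ! c)"
      "f ` nsets H 3 \<subseteq> {c}"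
      by (rule partn_lstE[OF N])
    then have "c < 2" by simp
    have H: "H \<subseteq> {..<N}" "card H = l" 
      using \<open>c < 2\<close> c(1) by (auto simp: nsets_def less_2_cases_iff)
    have "(if c = 0 then 1 else -1) * orient (q i) (q j) (q k) > 0"
      if "i \<in> H" "j \<in> H" "k \<in> H" "i < j" "j < k" for i j k
    proof -
      have "sorted_list_of_set (set [i, j, k]) = [i, j, k]"
        using that by (intro sorted_list_of_set.idem_if_sorted_distinct) auto
      then have f: "f {i, j, k} = (if orient (q i) (q j) (q k) > 0 then 0 else 1)"
        by (simp add: f_def Let_def)
      have "{i, j, k} \<in> nsets H 3" using that by (auto simp: nsets_def)
      then have "f {i, j, k} = c" using c(2) by blast
      \<comment> \<open>Colour 1 only says that the orientation is not positive; general position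
        makes it negative.\<close>
      moreover have "orient (q i) (q j) (q k) \<noteq> 0"
      proof
        assume "orient (q i) (q j) (q k) = 0"
        then have "collinear {q i, q j, q k}" by (rule orient_zero_collinear)
        moreover have "q i \<noteq> q j" "q j \<noteq> q k" "q i \<noteq> q k"
          using that subsetD[OF H(1)] by (simp_all add: inj_on_eq_iff[OF inj])
        ultimately show False
          using gp that H unfolding general_position_def by blast
      qed
      ultimately show ?thesis using f by (auto split: if_splits)
    qed
    then have "same_orientation H q" unfolding same_orientation_def by blast
    with H show "\<exists>H. H \<subseteq> {..<N} \<and> card H = l \<and> same_orientation H q" by blast
  qed
qed

text \<open>\<open>adj\<close> is read at increasing pairs only, so it describes a graph without
  having to be symmetric.\<close>

definition cliques_cover_nonedge ::
    "nat \<Rightarrow> (nat \<Rightarrow> nat \<Rightarrow> bool) \<Rightarrow> (nat \<Rightarrow> real^2) \<Rightarrow> nat \<Rightarrow> nat \<Rightarrow> nat set set \<Rightarrow> bool" where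
  "cliques_cover_nonedge m adj q u v \<T> \<longleftrightarrow>
     u < v \<and> v < m \<and> \<not> adj u v \<and> \<T> \<subseteq> Pow {..<m} \<and>
     (\<forall>T\<in>\<T>. (card T = 2 \<or> card T = 3) \<and> (\<forall>i\<in>T. \<forall>j\<in>T. i < j \<longrightarrow> adj i j)) \<and>
     closed_segment (q u) (q v) \<subseteq> (\<Union>T\<in>\<T>. convex hull (q ` T))"

lemma unavoidable_pattern:
  obtains m :: nat and adj :: "nat \<Rightarrow> nat \<Rightarrow> bool" where
    "\<forall>q. inj_on q {..<m} \<longrightarrow> general_position (q ` {..<m}) \<longrightarrow>
      (\<exists>u v \<T>. cliques_cover_nonedge m adj q u v \<T>)"
proof -
  obtain N :: nat where N: "\<And>q. inj_on q {..<N} \<Longrightarrow> general_position (q ` {..<N}) \<Longrightarrow>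
      \<exists>H. H \<subseteq> {..<N} \<and> card H = 6 \<and> same_orientation H q"
    by (rule ramsey_same_orientation[of 6]) blast
  \<comment> \<open>The whole set \<open>{..<N}\<close> has the largest code among its subsets, so
    there is room for one extra vertex per subset.\<close>
  define m where "m = Suc (N + set_encode {..<N})"
  \<comment> \<open>Read for \<open>i < j\<close>: the vertices below \<open>N\<close> form a
    clique, and for \<open>X \<subseteq> {..<N}\<close> the vertex \<open>N + set_encode X\<close>
    is joined exactly to \<open>X\<close>.\<close>
  define adj where "adj i j \<longleftrightarrow> j < N \<or> i < N \<and> i \<in> set_decode (j - N)" for i j
  show thesis
  proof (rule that, intro allI impI)
    fix q :: "nat \<Rightarrow> real^2"
    assume inj: "inj_on q {..<m}" and gp: "general_position (q ` {..<m})"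
    have Nm: "{..<N} \<subseteq> {..<m}" by (auto simp: m_def)
    have "inj_on q {..<N}" using inj_on_subset[OF inj Nm] .
    moreover have "general_position (q ` {..<N})"
      by (rule general_position_subset[OF gp image_mono[OF Nm]])
    ultimately obtain H where H: "H \<subseteq> {..<N}" "card H = 6" "same_orientation H q"
      using N by blast
    have fin: "finite H" using H(1) finite_subset by blast
    define h where "h i = sorted_list_of_set H ! i" for i
    have len: "length (sorted_list_of_set H) = 6" using H by simp
    have hH: "h i \<in> H" if "i < 6" for i
      using nth_mem[of i "sorted_list_of_set H"] that fin len by (simp add: h_def)
    have hmono: "strict_mono_on {..<6} h"
      using sorted_wrt_nth_less[OF strict_sorted_list_of_set[of H]] len
      by (auto simp: strict_mono_on_def h_def)
    have hlt: "h i < h j" if "i < j" "j < 6" for i j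
      using hmono that by (auto simp: strict_mono_on_def)
    have hN: "h i < N" if "i < 6" for i using hH[OF that] H by auto
    define X where "X = {h 0, h 2, h 4}"
    define b where "b = N + set_encode X"
    have XN: "X \<subseteq> {..<N}" using hN by (auto simp: X_def)
    have "set_encode X \<le> set_encode {..<N}"
      unfolding set_encode_def using XN by (intro sum_mono2) simp_all
    then have bm: "b < m" by (simp add: b_def m_def)
    have adj_b: "adj i b \<longleftrightarrow> i \<in> X" if "i < N" for i
    proof -
      have "set_decode (b - N) = X" using finite_subset[OF XN] by (simp add: b_def)
      then show ?thesis using that by (simp add: adj_def b_def)
    qed
    have nadj: "\<not> adj (h i) b" if "i \<in> {1, 3, 5}" for i
    proof -
      have "h i \<notin> X"
        using that hlt[of 0 1] hlt[of 1 2] hlt[of 2 3] hlt[of 3 4] hlt[of 4 5] unfolding X_def by auto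
      then show ?thesis using adj_b[of "h i"] hN[of i] that by auto
    qed
    have clique: "adj i j" if "j < N" for i j using that by (simp add: adj_def)
    have Nb: "i < b" if "i < N" for i using that by (simp add: b_def)
    show "\<exists>u v \<T>. cliques_cover_nonedge m adj q u v \<T>"
    proof (cases "q b \<in> convex hull (q ` H)")
      case True
      \<comment> \<open>Any corner outside \<open>X\<close> would do: its segment to
        \<open>q b\<close> stays in the hexagon, which the clique triangles cover.\<close>
      have "closed_segment (q (h 1)) (q b) \<subseteq> convex hull (q ` H)"
        by (rule closed_segment_subset[OF hull_inc True convex_convex_hull]) (simp add: hH)
      also have "\<dots> \<subseteq> (\<Union>T\<in>{T. T \<subseteq> H \<and> card T = 3}. convex hull (q ` T))"
        by (rule convex_hull_subset_triples[OF fin]) (simp add: H(2))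
      finally have "closed_segment (q (h 1)) (q b) \<subseteq> (\<Union>T\<in>{T. T \<subseteq> H \<and> card T = 3}. convex hull (q ` T))" .
      moreover have "\<forall>T\<in>{T. T \<subseteq> H \<and> card T = 3}. (card T = 2 \<or> card T = 3) \<and> (\<forall>i\<in>T. \<forall>j\<in>T. i < j \<longrightarrow> adj i j)"
      proof (intro ballI conjI impI)
        fix T i j assume "T \<in> {T. T \<subseteq> H \<and> card T = 3}" "j \<in> T"
        then have "j < N" using H(1) by auto
        then show "adj i j" by (rule clique)
      qed simp
      moreover have "{T. T \<subseteq> H \<and> card T = 3} \<subseteq> Pow {..<m}" using order_trans[OF H(1) Nm] by auto
      moreover have "h 1 < b" by (rule Nb[OF hN]) simp
      moreover have "\<not> adj (h 1) b" by (rule nadj) simp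
      ultimately have "cliques_cover_nonedge m adj q (h 1) b {T. T \<subseteq> H \<and> card T = 3}"
        using bm unfolding cliques_cover_nonedge_def by (intro conjI)
      then show ?thesis by blast
    next
      case False
      obtain x x' y where xy: "x \<in> {h 0, h 2, h 4}" "x' \<in> {h 0, h 2, h 4}" "y \<in> {h 1, h 3, h 5}"
        "closed_segment (q b) (q y) \<subseteq> convex hull {q b, q x, q x'} \<union> convex hull {q x, q x', q y}"
        by (rule alternating_hexagon_covered[OF H(3) hH hmono False fin])
      have lt: "x < N" "x' < N" "y < N" using xy(1-3) hN by auto
      have ny: "\<not> adj y b" using xy(3) nadj by auto
      have xX: "x \<in> X" "x' \<in> X" using xy(1,2) by (simp_all add: X_def)
      have "y \<notin> X" using ny adj_b lt by blast
      then have neq: "y \<noteq> x" "y \<noteq> x'" "b \<noteq> x" "b \<noteq> x'" using xX lt Nb[of x] Nb[of x'] by auto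
      have "closed_segment (q y) (q b) \<subseteq> (\<Union>T\<in>{{b, x, x'}, {x, x', y}}. convex hull (q ` T))"
        using xy(4) by (simp add: closed_segment_commute)
      moreover have "\<forall>T\<in>{{b, x, x'}, {x, x', y}}. (card T = 2 \<or> card T = 3) \<and> (\<forall>i\<in>T. \<forall>j\<in>T. i < j \<longrightarrow> adj i j)"
      proof -
        have "card {b, x, x'} = 2 \<or> card {b, x, x'} = 3" "card {x, x', y} = 2 \<or> card {x, x', y} = 3"
          using neq by (auto simp: card_insert_if)
        moreover have "\<forall>i\<in>{b, x, x'}. \<forall>j\<in>{b, x, x'}. i < j \<longrightarrow> adj i j"
        proof (intro ballI impI)
          fix i j assume ij: "i \<in> {b, x, x'}" "j \<in> {b, x, x'}" "i < j"
          show "adj i j"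
          proof (cases "j = b")
            case True
            then have "i = x \<or> i = x'" using ij by auto
            then have "i \<in> X" "i < N" using xX lt by auto
            then show ?thesis using adj_b True by simp
          next
            case False
            then have "j < N" using ij(2) lt by auto
            then show ?thesis by (rule clique)
          qed
        qed
        moreover have "\<forall>i\<in>{x, x', y}. \<forall>j\<in>{x, x', y}. i < j \<longrightarrow> adj i j"
          using lt by (auto intro: clique)
        ultimately show ?thesis by blast
      qed
      moreover have "{{b, x, x'}, {x, x', y}} \<subseteq> Pow {..<m}" using lt bm Nm by auto
      ultimately have "cliques_cover_nonedge m adj q y b {{b, x, x'}, {x, x', y}}"
        using bm Nb[OF lt(3)] ny unfolding cliques_cover_nonedge_def by (intro conjI)
      then show ?thesis by blast
    qed
  qed
qed

subsection \<open>Set families avoiding disjoint patterns\<close>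

text \<open>For a random subset of \<open>P\<close> the events at the disjoint sets
  \<open>D t\<close> are independent, and each pattern is missed with probability 1 - 1/2^M. The
  inequality is this estimate with denominators cleared, proved by removing one \<open>D t\<close>
  after another from \<open>P\<close>.\<close>

lemma card_avoiding_patterns:
  assumes "finite I" "finite P" "disjoint_family_on D I"
    and "\<And>t. t \<in> I \<Longrightarrow> D t \<subseteq> P \<and> card (D t) = M \<and> F t \<subseteq> D t"
  shows "card {E \<in> Pow P. \<forall>t\<in>I. E \<inter> D t \<noteq> F t} * 2 ^ (M * card I)
           \<le> (2 ^ M - 1) ^ card I * 2 ^ card P"
  using assms
proof (induction I arbitrary: P rule: finite_induct)
  case empty
  have "{E \<in> Pow P. \<forall>t\<in>{}. E \<inter> D t \<noteq> F t} = Pow P" by auto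
  then have "card {E \<in> Pow P. \<forall>t\<in>{}. E \<inter> D t \<noteq> F t} = 2 ^ card P"
    using card_Pow[of P] empty.prems(1) by (simp only:)
  then show ?case by (simp only: card.empty) simp
next
  case (insert t I)
  define Q where "Q = P - D t"
  define A where "A = {E \<in> Pow P. \<forall>s\<in>insert t I. E \<inter> D s \<noteq> F s}"
  define B where "B = {E \<in> Pow Q. \<forall>s\<in>I. E \<inter> D s \<noteq> F s}"
  have t: "D t \<subseteq> P" "card (D t) = M" "F t \<subseteq> D t" using insert.prems(3)[of t] by simp_all
  have finD: "finite (D t)" by (rule finite_subset[OF t(1) insert.prems(1)])
  have finB: "finite B" using insert.prems(1) by (simp add: B_def Q_def)
  have disj: "D s \<inter> D t = {}" if "s \<in> I" for s
    using disjoint_family_onD[OF insert.prems(2), of s t] insert.hyps(2) that by auto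
  have DQ: "D s \<subseteq> Q \<and> card (D s) = M \<and> F s \<subseteq> D s" if "s \<in> I" for s
    using insert.prems(3)[of s] disj[OF that] that by (auto simp: Q_def)
  have "finite Q" "disjoint_family_on D I"
    using insert.prems(1,2) by (auto simp: Q_def disjoint_family_on_def)
  then have IH: "card B * 2 ^ (M * card I) \<le> (2 ^ M - 1) ^ card I * 2 ^ card Q"
    unfolding B_def using DQ by (rule insert.IH)
  \<comment> \<open>A set is determined by its parts inside and outside \<open>D t\<close>. Inside,
    only \<open>F t\<close> is excluded; outside, the induction hypothesis counts.\<close>
  have "card A \<le> card ((Pow (D t) - {F t}) \<times> B)"
  proof (rule card_inj_on_le[of "\<lambda>E. (E \<inter> D t, E - D t)"])
    show "inj_on (\<lambda>E. (E \<inter> D t, E - D t)) A"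
      by (rule inj_onI) (metis Int_Diff_Un prod.inject)
    show "(\<lambda>E. (E \<inter> D t, E - D t)) ` A \<subseteq> (Pow (D t) - {F t}) \<times> B"
    proof (intro image_subsetI)
      fix E assume E: "E \<in> A"
      have "(E - D t) \<inter> D s = E \<inter> D s" if "s \<in> I" for s using disj[OF that] by blast
      with E show "(E \<inter> D t, E - D t) \<in> (Pow (D t) - {F t}) \<times> B"
        by (auto simp: A_def B_def Q_def)
    qed
    show "finite ((Pow (D t) - {F t}) \<times> B)" using finD finB by simp
  qed
  also have "\<dots> = (2 ^ M - 1) * card B"
    using t finD by (simp add: card_cartesian_product card_Diff_singleton card_Pow)
  finally have AB: "card A \<le> (2 ^ M - 1) * card B" .
  have card: "card P = card Q + M"
    using t finD card_mono[OF insert.prems(1) t(1)] by (simp add: Q_def card_Diff_subset)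
  have "card A * 2 ^ (M * card (insert t I)) = card A * (2 ^ M * 2 ^ (M * card I))"
    using insert.hyps by (simp add: power_add)
  also have "\<dots> \<le> (2 ^ M - 1) * card B * (2 ^ M * 2 ^ (M * card I))"
    using AB by (rule mult_right_mono) simp
  also have "\<dots> = (2 ^ M - 1) * 2 ^ M * (card B * 2 ^ (M * card I))"
    by (simp only: mult_ac)
  also have "\<dots> \<le> (2 ^ M - 1) * 2 ^ M * ((2 ^ M - 1) ^ card I * 2 ^ card Q)"
    using IH by (rule mult_left_mono) simp
  also have "\<dots> = (2 ^ M - 1) ^ card (insert t I) * 2 ^ card P"
    using insert.hyps by (simp add: card power_add mult_ac)
  finally show ?case unfolding A_def .
qed

lemma card_avoiding_patterns_real:
  assumes "finite I" "finite P" "disjoint_family_on D I"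
    and "\<And>t. t \<in> I \<Longrightarrow> D t \<subseteq> P \<and> card (D t) = M \<and> F t \<subseteq> D t"
  shows "real (card {E \<in> Pow P. \<forall>t\<in>I. E \<inter> D t \<noteq> F t}) \<le> (1 - 1 / 2 ^ M) ^ card I * 2 ^ card P"
proof -
  let ?c = "card {E \<in> Pow P. \<forall>t\<in>I. E \<inter> D t \<noteq> F t}"
  have "real (?c * 2 ^ (M * card I)) \<le> real ((2 ^ M - 1) ^ card I * 2 ^ card P)"
    using card_avoiding_patterns[OF assms] by (simp only: of_nat_le_iff)
  also have "\<dots> = (2 ^ M - 1) ^ card I * 2 ^ card P" by (simp add: of_nat_diff)
  finally have "real ?c \<le> (2 ^ M - 1) ^ card I * 2 ^ card P / (2 ^ M) ^ card I"
    by (simp add: pos_le_divide_eq power_mult)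
  also have "\<dots> = ((2 ^ M - 1) / 2 ^ M) ^ card I * 2 ^ card P" by (simp add: power_divide)
  also have "((2 ^ M - 1) / 2 ^ M :: real) = 1 - 1 / 2 ^ M" by (simp add: diff_divide_distrib)
  finally show ?thesis .
qed

subsection \<open>Graphs containing a pattern in every long sequence of vertices\<close>

definition pairs :: "'a set \<Rightarrow> 'a set set" where
  "pairs S = {e. e \<subseteq> S \<and> card e = 2}"

lemma finite_pairs: "finite S \<Longrightarrow> finite (pairs S)"
  by (simp add: pairs_def)

text \<open>
  The vertices are arranged in a grid with \<open>m\<close> columns of height \<open>m q\<close>; the parameters
  \<open>a, b < q\<close> describe the line of slope \<open>b\<close> starting at height \<open>a\<close>. Two such lines share at most one
  point, so they have no pair in common.
\<close>

definition transversal :: "nat \<Rightarrow> nat \<Rightarrow> nat \<times> nat \<Rightarrow> nat \<Rightarrow> nat" where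
  "transversal m q = (\<lambda>(a, b) i. i * (m * q) + (a + i * b))"

text \<open>The reason for columns of height \<open>m * q\<close>: a line starting below
  \<open>q\<close> with slope below \<open>q\<close> stays within this height over \<open>m\<close>
  columns.\<close>

lemma transversal_offset_less:
  assumes "a < q" "b < q" "i < (m::nat)"
  shows "a + i * b < m * q"
proof -
  have "a + i * b < q + i * q" using assms by (intro add_less_le_mono) auto
  also have "\<dots> = Suc i * q" by simp
  also have "\<dots> \<le> m * q" using assms by (intro mult_le_mono1) simp
  finally show ?thesis .
qed

lemma transversal_less:
  assumes "t \<in> {..<q} \<times> {..<q}" "i < m"
  shows "transversal m q t i < m * (m * q)"
proof -
  obtain a b where t: "t = (a, b)" "a < q" "b < q" using assms by auto
  have "transversal m q t i < i * (m * q) + m * q"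
    using transversal_offset_less[OF t(2,3) assms(2)] by (simp add: t transversal_def)
  also have "\<dots> = Suc i * (m * q)" by simp
  also have "\<dots> \<le> m * (m * q)" using assms by (intro mult_le_mono1) simp
  finally show ?thesis .
qed

text \<open>Division by the column height recovers the column, and the remainder is the height in
  it.\<close>

lemma transversal_eqD:
  assumes "t \<in> {..<q} \<times> {..<q}" "t' \<in> {..<q} \<times> {..<q}" "i < m" "i' < m"
    and "transversal m q t i = transversal m q t' i'"
  shows "i = i'" "fst t + i * snd t = fst t' + i * snd t'"
proof -
  obtain a b a' b' where t: "t = (a, b)" "a < q" "b < q" "t' = (a', b')" "a' < q" "b' < q"
    using assms by auto
  have l: "a + i * b < m * q" "a' + i' * b' < m * q"
    using t assms transversal_offset_less by auto
  have eq: "i * (m * q) + (a + i * b) = i' * (m * q) + (a' + i' * b')"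
    using assms(5) by (simp add: t transversal_def)
  have quot: "(c * M + r) div M = c" if "r < M" for c r M :: nat
    using that by (cases "M = 0") auto
  have "i = (i * (m * q) + (a + i * b)) div (m * q)" by (rule quot[OF l(1), symmetric])
  also have "\<dots> = (i' * (m * q) + (a' + i' * b')) div (m * q)" by (simp only: eq)
  also have "\<dots> = i'" by (rule quot[OF l(2)])
  finally show "i = i'" .
  with eq show "fst t + i * snd t = fst t' + i * snd t'" by (simp add: t)
qed

lemma transversal_inj: "t \<in> {..<q} \<times> {..<q} \<Longrightarrow> inj_on (transversal m q t) {..<m}"
  by (rule inj_onI) (use transversal_eqD(1) in blast)

lemma two_point_line_unique:
  fixes a b a' b' i j :: nat
  assumes "a + i * b = a' + i * b'" "a + j * b = a' + j * b'" "i \<noteq> j"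
  shows "a = a' \<and> b = b'"
proof -
  have "int a + int i * int b = int a' + int i * int b'" "int a + int j * int b = int a' + int j * int b'"
    using assms(1,2) by (metis of_nat_add of_nat_mult)+
  then have "(int i - int j) * (int b - int b') = 0" by (simp add: algebra_simps)
  then have "b = b'" using assms(3) by simp
  with assms(1) show ?thesis by simp
qed

text \<open>A common pair would give two columns in which both lines have the same height, and two
  points determine a line.\<close>

lemma transversal_pairs_disjoint:
  assumes "inj_on s {..<m * (m * q)}"
  shows "disjoint_family_on (\<lambda>t. image (s \<circ> transversal m q t) ` pairs {..<m}) ({..<q} \<times> {..<q})"
proof (unfold disjoint_family_on_def, intro ballI impI, rule ccontr)
  fix t t' assume tt: "t \<in> {..<q} \<times> {..<q}" "t' \<in> {..<q} \<times> {..<q}" "t \<noteq> t'"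
  assume "image (s \<circ> transversal m q t) ` pairs {..<m} \<inter> image (s \<circ> transversal m q t') ` pairs {..<m} \<noteq> {}"
  then obtain e e' where e: "e \<in> pairs {..<m}" "e' \<in> pairs {..<m}"
    and eq: "(s \<circ> transversal m q t) ` e = (s \<circ> transversal m q t') ` e'" by blast
  have line: "fst t + i * snd t = fst t' + i * snd t'" if "i \<in> e" for i
  proof -
    have "s (transversal m q t i) \<in> (s \<circ> transversal m q t') ` e'" using that eq by auto
    then obtain i' where i': "i' \<in> e'" "s (transversal m q t i) = s (transversal m q t' i')" by auto
    have lt: "i < m" "i' < m" using that i' e by (auto simp: pairs_def)
    have "transversal m q t i = transversal m q t' i'"
      using i'(2) transversal_less[OF tt(1) lt(1)] transversal_less[OF tt(2) lt(2)]
      by (intro inj_onD[OF assms]) auto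
    from transversal_eqD(2)[OF tt(1,2) lt this] show ?thesis .
  qed
  obtain i j where "e = {i, j}" "i \<noteq> j" using e(1) by (auto simp: pairs_def card_2_iff)
  then have "fst t = fst t' \<and> snd t = snd t'"
    by (intro two_point_line_unique[of _ i _ _ _ j] line) auto
  with tt(3) show False by (simp add: prod_eq_iff)
qed

text \<open>An induced copy of the pattern among the first \<open>k\<close> terms of
  \<open>s\<close>; \<open>\<tau>\<close> need not be increasing.\<close>

definition contains_pattern ::
    "nat set set \<Rightarrow> nat \<Rightarrow> (nat \<Rightarrow> nat \<Rightarrow> bool) \<Rightarrow> nat \<Rightarrow> (nat \<Rightarrow> nat) \<Rightarrow> bool" where
  "contains_pattern E m adj k s \<longleftrightarrow> (\<exists>\<tau>. inj_on \<tau> {..<m} \<and> \<tau> ` {..<m} \<subseteq> {..<k} \<and>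
     (\<forall>i j. i < j \<and> j < m \<longrightarrow> ({s (\<tau> i), s (\<tau> j)} \<in> E \<longleftrightarrow> adj i j)))"

text \<open>The \<open>q * q\<close> transversals are edge-disjoint places with
  \<open>m choose 2\<close> pairs each, and a graph avoiding the pattern must differ from it at
  every one of them.\<close>

lemma card_graphs_avoiding_pattern:
  assumes s: "inj_on s {..<m * (m * q)}" "s ` {..<m * (m * q)} \<subseteq> {..<n}"
  shows "real (card {E \<in> Pow (pairs {..<n}). \<not> contains_pattern E m adj (m * (m * q)) s})
           \<le> (1 - 1 / 2 ^ (m choose 2)) ^ (q * q) * 2 ^ card (pairs {..<n})"
proof -
  define I where "I = {..<q} \<times> {..<q}"
  define f where "f t = s \<circ> transversal m q t" for t
  define D where "D t = image (f t) ` pairs {..<m}" for t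
  \<comment> \<open>\<open>Min\<close> and \<open>Max\<close> turn an unordered pair into the
    increasing one at which \<open>adj\<close> is read.\<close>
  define F where "F t = image (f t) ` {e \<in> pairs {..<m}. adj (Min e) (Max e)}" for t
  have tr: "transversal m q t ` {..<m} \<subseteq> {..<m * (m * q)}" if "t \<in> I" for t
    using transversal_less that by (auto simp: I_def)
  have injf: "inj_on (f t) {..<m}" if "t \<in> I" for t
    unfolding f_def using transversal_inj[of t q m] that inj_on_subset[OF s(1) tr[OF that]]
    by (intro comp_inj_on) (auto simp: I_def)
  have fn: "f t ` {..<m} \<subseteq> {..<n}" if "t \<in> I" for t
    using tr[OF that] s(2) unfolding f_def image_comp[symmetric] by blast
  have injD: "inj_on (image (f t)) (pairs {..<m})" if "t \<in> I" for t
    using inj_on_image_Pow[OF injf[OF that]] by (rule inj_on_subset) (auto simp: pairs_def)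
  have DF: "D t \<subseteq> pairs {..<n} \<and> card (D t) = m choose 2 \<and> F t \<subseteq> D t" if t: "t \<in> I" for t
  proof (intro conjI)
    show "D t \<subseteq> pairs {..<n}"
    proof
      fix x assume "x \<in> D t"
      then obtain e where e: "e \<subseteq> {..<m}" "card e = 2" "x = f t ` e" by (auto simp: D_def pairs_def)
      then have "card x = 2" using inj_on_subset[OF injf[OF t]] by (simp add: card_image)
      moreover have "x \<subseteq> {..<n}" using e fn[OF t] by blast
      ultimately show "x \<in> pairs {..<n}" by (simp add: pairs_def)
    qed
    have "card (pairs {..<m}) = m choose 2"
      unfolding pairs_def using n_subsets[of "{..<m}" 2] by simp
    then show "card (D t) = m choose 2" unfolding D_def by (simp add: card_image[OF injD[OF t]])
    show "F t \<subseteq> D t" unfolding F_def D_def by blast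
  qed
  have "{E \<in> Pow (pairs {..<n}). \<not> contains_pattern E m adj (m * (m * q)) s}
      \<subseteq> {E \<in> Pow (pairs {..<n}). \<forall>t\<in>I. E \<inter> D t \<noteq> F t}"
  proof (intro subsetI CollectI conjI ballI notI)
    fix E assume "E \<in> {E \<in> Pow (pairs {..<n}). \<not> contains_pattern E m adj (m * (m * q)) s}"
    then show "E \<in> Pow (pairs {..<n})" by simp
  next
    fix E t assume E: "E \<in> {E \<in> Pow (pairs {..<n}). \<not> contains_pattern E m adj (m * (m * q)) s}"
      and t: "t \<in> I" and eq: "E \<inter> D t = F t"
    have "{s (transversal m q t i), s (transversal m q t j)} \<in> E \<longleftrightarrow> adj i j" if ij: "i < j" "j < m" for i j
    proof -
      have e: "{i, j} \<in> pairs {..<m}" using ij by (auto simp: pairs_def)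
      have "f t ` {i, j} \<in> E \<longleftrightarrow> f t ` {i, j} \<in> F t"
        using e eq unfolding D_def by blast
      also have "\<dots> \<longleftrightarrow> {i, j} \<in> {e \<in> pairs {..<m}. adj (Min e) (Max e)}"
        unfolding F_def by (rule inj_on_image_mem_iff[OF injD[OF t] e]) simp
      also have "\<dots> \<longleftrightarrow> adj i j" using e ij by simp
      finally show ?thesis by (simp add: f_def)
    qed
    moreover have "inj_on (transversal m q t) {..<m}" using t transversal_inj by (simp add: I_def)
    ultimately have "contains_pattern E m adj (m * (m * q)) s"
      unfolding contains_pattern_def using tr[OF t] by blast
    with E show False by simp
  qed
  then have "card {E \<in> Pow (pairs {..<n}). \<not> contains_pattern E m adj (m * (m * q)) s}
      \<le> card {E \<in> Pow (pairs {..<n}). \<forall>t\<in>I. E \<inter> D t \<noteq> F t}"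
    by (intro card_mono) (simp_all add: finite_pairs)
  also have "real (card {E \<in> Pow (pairs {..<n}). \<forall>t\<in>I. E \<inter> D t \<noteq> F t})
      \<le> (1 - 1 / 2 ^ (m choose 2)) ^ card I * 2 ^ card (pairs {..<n})"
    using DF transversal_pairs_disjoint[OF s(1)]
    by (intro card_avoiding_patterns_real) (auto simp: I_def D_def f_def finite_pairs)
  also have "card I = q * q" by (simp add: I_def)
  finally show ?thesis by simp
qed

text \<open>Union bound: there are at most \<open>n ^ k\<close> injective sequences of length
  \<open>k\<close>, and the bad graphs of all of them together do not exhaust the graphs on
  \<open>{..<n}\<close>.\<close>

lemma exists_graph_containing_pattern:
  assumes small: "real n ^ (m * (m * q)) * (1 - 1 / 2 ^ (m choose 2)) ^ (q * q) < 1"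
  obtains E where "E \<subseteq> pairs {..<n}"
    "\<And>s. inj_on s {..<m * (m * q)} \<Longrightarrow> s ` {..<m * (m * q)} \<subseteq> {..<n} \<Longrightarrow>
      contains_pattern E m adj (m * (m * q)) s"
proof -
  define k where "k = m * (m * q)"
  define P where "P = pairs {..<n}"
  define x :: real where "x = (1 - 1 / 2 ^ (m choose 2)) ^ (q * q)"
  define S where "S = {s \<in> {..<k} \<rightarrow>\<^sub>E {..<n}. inj_on s {..<k}}"
  define Bad where "Bad s = {E \<in> Pow P. \<not> contains_pattern E m adj k s}" for s
  have finP: "finite P" by (simp add: P_def finite_pairs)
  have finPi: "finite ({..<k} \<rightarrow>\<^sub>E {..<n})" by (simp add: finite_PiE)
  then have finS: "finite S" by (simp add: S_def)
  have "card S \<le> card ({..<k} \<rightarrow>\<^sub>E {..<n})"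
    unfolding S_def using finPi by (intro card_mono) auto
  also have "\<dots> = n ^ k" by (simp add: card_PiE)
  finally have cS: "real (card S) \<le> real n ^ k" by (metis of_nat_le_iff of_nat_power)
  have x0: "x \<ge> 0" unfolding x_def by simp
  have bad: "real (card (Bad s)) \<le> x * 2 ^ card P" if "s \<in> S" for s
    unfolding Bad_def P_def x_def k_def using that
    by (intro card_graphs_avoiding_pattern) (auto simp: S_def k_def)
  have "real (card (\<Union>s\<in>S. Bad s)) \<le> (\<Sum>s\<in>S. real (card (Bad s)))"
    using card_UN_le[OF finS, of Bad] by (metis of_nat_le_iff of_nat_sum)
  also have "\<dots> \<le> real (card S) * (x * 2 ^ card P)"
    using bad by (intro sum_bounded_above) auto
  also have "\<dots> \<le> real n ^ k * (x * 2 ^ card P)"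
    using cS x0 by (intro mult_right_mono) auto
  also have "\<dots> = (real n ^ k * x) * 2 ^ card P" by simp
  also have "\<dots> < 1 * 2 ^ card P"
    using small by (intro mult_strict_right_mono) (auto simp: k_def x_def)
  also have "\<dots> = real (card (Pow P))" using finP by (simp add: card_Pow)
  finally have "card (\<Union>s\<in>S. Bad s) < card (Pow P)" by simp
  moreover have finU: "finite (\<Union>s\<in>S. Bad s)" using finS finP by (simp add: Bad_def)
  ultimately have "\<not> Pow P \<subseteq> (\<Union>s\<in>S. Bad s)"
    using card_mono[OF finU, of "Pow P"] by linarith
  then obtain E where E: "E \<in> Pow P" "\<And>s. s \<in> S \<Longrightarrow> E \<notin> Bad s" by blast
  show thesis
  proof (rule that)
    show "E \<subseteq> pairs {..<n}" using E(1) by (simp add: P_def)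
    fix s assume s: "inj_on s {..<m * (m * q)}" "s ` {..<m * (m * q)} \<subseteq> {..<n}"
    \<comment> \<open>The union bound runs over the finite set of extensional functions, so
      \<open>s\<close> is first cut down to its relevant terms.\<close>
    define s' where "s' = restrict s {..<k}"
    have eq: "s' i = s i" if "i < k" for i using that by (simp add: s'_def)
    have "s' \<in> S"
      using s by (auto simp: S_def s'_def k_def inj_on_def)
    then have "contains_pattern E m adj k s'" using E by (auto simp: Bad_def)
    then obtain \<tau> where \<tau>: "inj_on \<tau> {..<m}" "\<tau> ` {..<m} \<subseteq> {..<k}"
      "\<And>i j. i < j \<Longrightarrow> j < m \<Longrightarrow> {s' (\<tau> i), s' (\<tau> j)} \<in> E \<longleftrightarrow> adj i j"
      unfolding contains_pattern_def by blast
    have "{s (\<tau> i), s (\<tau> j)} \<in> E \<longleftrightarrow> adj i j" if "i < j" "j < m" for i j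
    proof -
      have "i < m" using that by simp
      then have "\<tau> i < k" "\<tau> j < k" using \<tau>(2) that(2) by auto
      then show ?thesis using \<tau>(3)[OF that] eq by simp
    qed
    then show "contains_pattern E m adj (m * (m * q)) s"
      unfolding contains_pattern_def using \<tau>(1,2) k_def by blast
  qed
qed

text \<open>By \<open>1 - x \<le> exp (- x)\<close> the product is at most the exponential of
  \<open>q * (m * m * ln n - q * x)\<close>. The number of places is quadratic in \<open>q\<close>
  while the sequence length is linear, so \<open>q\<close> of order \<open>ln n\<close>
  suffices.\<close>

lemma union_bound_small:
  fixes n m q :: nat and x :: real
  assumes "n \<ge> 1" "0 \<le> x" "x \<le> 1" "q > 0" "real (m * m) * ln n < real q * x"
  shows "real n ^ (m * (m * q)) * (1 - x) ^ (q * q) < 1"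
proof -
  have "real n ^ (m * (m * q)) * (1 - x) ^ (q * q) \<le> exp (real (m * (m * q)) * ln n) * exp (- x) ^ (q * q)"
  proof (intro mult_mono power_mono)
    show "real n ^ (m * (m * q)) \<le> exp (real (m * (m * q)) * ln n)"
      unfolding exp_of_nat_mult using assms(1) by simp
    show "1 - x \<le> exp (- x)" using exp_ge_add_one_self[of "-x"] by simp
  qed (use assms in auto)
  also have "\<dots> = exp (real q * (real (m * m) * ln n - real q * x))"
    unfolding exp_of_nat_mult[symmetric] exp_add[symmetric] by (simp add: algebra_simps)
  also have "\<dots> < exp 0"
    using assms by (intro exp_less_mono) (simp add: mult_pos_neg)
  finally show ?thesis by simp
qed

subsection \<open>Every graph has an obstacle representation\<close>

text \<open>Finitely many points and lines have measure zero, which an open ball does not.\<close>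

lemma generic_point:
  fixes S U :: "(real^2) set"
  assumes "finite S" "open U" "U \<noteq> {}"
  obtains c where "c \<in> U" "c \<notin> S" "\<And>a b. a \<in> S \<Longrightarrow> b \<in> S \<Longrightarrow> a \<noteq> b \<Longrightarrow> c \<notin> affine hull {a, b}"
proof -
  define L where "L = S \<union> (\<Union>(a, b)\<in>S \<times> S. affine hull {a, b})"
  have "negligible (affine hull {a, b})" for a b :: "real^2"
  proof -
    have "interior (affine hull {a, b}) = {}"
      by (rule empty_interior_affine_hull) (auto simp: card_insert_if)
    then show ?thesis by (simp add: negligible_convex_interior affine_imp_convex)
  qed
  then have "negligible (\<Union>(a, b)\<in>S \<times> S. affine hull {a, b})"
    using assms(1) by (intro negligible_Union) auto
  then have negl: "negligible L"
    unfolding L_def by (rule negligible_Un[OF negligible_finite[OF assms(1)]])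
  obtain x e where xe: "e > 0" "ball x e \<subseteq> U"
    using assms(2,3) by (metis all_not_in_conv openE)
  have "\<not> negligible (ball x e)"
    using xe(1) by (simp add: negligible_convex_interior interior_open)
  then have "\<not> ball x e \<subseteq> L" using negl negligible_subset by blast
  then obtain c where c: "c \<in> ball x e" "c \<notin> L" by blast
  show thesis
  proof (rule that)
    show "c \<in> U" using c xe by blast
    show "c \<notin> S" using c by (simp add: L_def)
    show "c \<notin> affine hull {a, b}" if "a \<in> S" "b \<in> S" for a b
      using c(2) that by (auto simp: L_def)
  qed
qed

lemma general_position_insert:
  assumes "general_position S" "c \<notin> S"
    and "\<And>a b. a \<in> S \<Longrightarrow> b \<in> S \<Longrightarrow> a \<noteq> b \<Longrightarrow> c \<notin> affine hull {a, b}"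
  shows "general_position (insert c S)"
proof -
  have new: "\<not> collinear {a, b, c}" if "a \<in> S" "b \<in> S" "a \<noteq> b" for a b
    using assms(3)[OF that] that(3) by (simp add: collinear_3_affine_hull)
  have perm: "{c, a, b} = {a, b, c}" "{a, c, b} = {a, b, c}" for a b by auto
  show ?thesis
    unfolding general_position_def
  proof (intro ballI impI, elim conjE)
    fix x y z assume h: "x \<in> insert c S" "y \<in> insert c S" "z \<in> insert c S" "x \<noteq> y" "y \<noteq> z" "x \<noteq> z"
    consider "x = c" "y \<in> S" "z \<in> S" | "y = c" "x \<in> S" "z \<in> S" | "z = c" "x \<in> S" "y \<in> S"
      | "x \<in> S" "y \<in> S" "z \<in> S" using h by auto
    then show "\<not> collinear {x, y, z}"
    proof cases
      case 1 then show ?thesis using new[of y z] h perm(1)[of y z] by simp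
    next
      case 2 then show ?thesis using new[of x z] h perm(2)[of x z] by simp
    next
      case 3 then show ?thesis using new[of x y] h by simp
    next
      case 4 then show ?thesis using assms(1) h unfolding general_position_def by simp
    qed
  qed
qed

lemma general_position_generic_insert:
  fixes S U :: "(real^2) set"
  assumes "finite S" "general_position S" "open U" "U \<noteq> {}"
  obtains c where "c \<in> U" "c \<notin> S" "general_position (insert c S)"
  by (rule generic_point[OF assms(1,3,4)]) (use general_position_insert[OF assms(2)] in blast)

lemma exists_general_position:
  obtains p :: "nat \<Rightarrow> real^2" where "inj_on p {..<n}" "general_position (p ` {..<n})"
proof -
  have "\<exists>S::(real^2) set. finite S \<and> card S = n \<and> general_position S"
  proof (induction n)
    case 0
    have "general_position {}" by (simp add: general_position_def)
    then show ?case by (intro exI[of _ "{}"]) simp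
  next
    case (Suc n)
    then obtain S :: "(real^2) set" where S: "finite S" "card S = n" "general_position S" by blast
    obtain c where "c \<in> (UNIV :: (real^2) set)" "c \<notin> S" "general_position (insert c S)"
      by (rule general_position_generic_insert[OF S(1,3) open_UNIV UNIV_not_empty])
    then show ?case using S by (intro exI[of _ "insert c S"]) simp
  qed
  then obtain S :: "(real^2) set" where S: "finite S" "card S = n" "general_position S" by blast
  obtain p where "bij_betw p {0..<card S} S" using ex_bij_betw_nat_finite[OF S(1)] by blast
  then have "inj_on p {..<n}" "p ` {..<n} = S"
    using S(2) by (simp_all add: bij_betw_def atLeast0LessThan)
  then show thesis using that S(3) by simp
qed

section \<open>Triangles as polygonal regions and their vertices\<close>

lemma general_position_orient_nonzero:
  assumes "general_position S" "a \<in> S" "b \<in> S" "c \<in> S" "a \<noteq> b" "b \<noteq> c" "a \<noteq> c"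
  shows "orient a b c \<noteq> 0"
  using assms orient_zero_collinear unfolding general_position_def by blast

text \<open>The three quotients of signed areas are the barycentric coordinates of
  \<open>x\<close>.\<close>

lemma triangle_eq_orient:
  assumes D: "orient a b c \<noteq> 0"
  shows "convex hull {a, b, c} = {x. orient x b c / orient a b c \<ge> 0 \<and>
    orient a x c / orient a b c \<ge> 0 \<and> orient a b x / orient a b c \<ge> 0}"
proof (intro equalityI subsetI)
  fix x assume "x \<in> convex hull {a, b, c}"
  then obtain u v w where u: "u \<ge> 0" "v \<ge> 0" "w \<ge> 0" "u + v + w = 1" "x = u *\<^sub>R a + v *\<^sub>R b + w *\<^sub>R c"
    unfolding convex_hull_3 by blast
  have u': "u = 1 - v - w" using u(4) by simp
  have "orient x b c = u * orient a b c" "orient a x c = v * orient a b c" "orient a b x = w * orient a b c"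
    unfolding u(5) orient_def u' by (simp_all add: algebra_simps)
  then show "x \<in> {x. orient x b c / orient a b c \<ge> 0 \<and>
    orient a x c / orient a b c \<ge> 0 \<and> orient a b x / orient a b c \<ge> 0}"
    using u D by simp
next
  fix x assume x: "x \<in> {x. orient x b c / orient a b c \<ge> 0 \<and>
    orient a x c / orient a b c \<ge> 0 \<and> orient a b x / orient a b c \<ge> 0}"
  have sum: "orient x b c / orient a b c + orient a x c / orient a b c + orient a b x / orient a b c = 1"
  proof -
    have "orient x b c + orient a x c + orient a b x = orient a b c"
      by (simp add: orient_def algebra_simps)
    then show ?thesis using D by (simp add: add_divide_distrib[symmetric])
  qed
  have "orient a b c *\<^sub>R x = orient x b c *\<^sub>R a + orient a x c *\<^sub>R b + orient a b x *\<^sub>R c"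
    by (simp add: orient_def vec_eq_iff forall_2 algebra_simps)
  then have "(1 / orient a b c) *\<^sub>R (orient a b c *\<^sub>R x)
    = (1 / orient a b c) *\<^sub>R (orient x b c *\<^sub>R a + orient a x c *\<^sub>R b + orient a b x *\<^sub>R c)" by simp
  then have "x = (orient x b c / orient a b c) *\<^sub>R a + (orient a x c / orient a b c) *\<^sub>R b
    + (orient a b x / orient a b c) *\<^sub>R c"
    using D by (simp add: scaleR_add_right)
  then show "x \<in> convex hull {a, b, c}"
    unfolding convex_hull_3 using sum x by blast
qed

text \<open>At a point inside the side \<open>a b\<close> the barycentric coordinates of
  \<open>a\<close> and \<open>b\<close> are positive, and they remain so nearby. Only the inequality
  for the third coordinate is left, and it defines a half-plane.\<close>

lemma triangle_halfplane_near_side: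
  assumes D: "orient a b c \<noteq> 0" and v: "v \<in> closed_segment a b" "v \<noteq> a" "v \<noteq> b"
  shows "\<exists>n e. n \<noteq> 0 \<and> e > 0 \<and> convex hull {a, b, c} \<inter> ball v e = {x. n \<bullet> x \<le> n \<bullet> v} \<inter> ball v e"
proof -
  let ?D = "orient a b c"
  obtain t where t: "0 \<le> t" "t \<le> 1" "v = (1 - t) *\<^sub>R a + t *\<^sub>R b" using v(1) by (auto simp: in_segment)
  have "t \<noteq> 0" "t \<noteq> 1" using t(3) v(2,3) by auto
  with t have t01: "0 < t" "t < 1" by auto
  \<comment> \<open>Dividing by the signed area makes \<open>n\<close> point out of the triangle for
    either orientation.\<close>
  define d where "d = - 1 / ?D"
  define n :: "real^2" where "n = d *\<^sub>R vector [- (b$2 - a$2), b$1 - a$1]"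
  define O1 where "O1 = {x. orient x b c / ?D > 0}"
  define O2 where "O2 = {x. orient a x c / ?D > 0}"
  have "open O1" "open O2"
    unfolding O1_def O2_def orient_def by (intro open_Collect_less continuous_intros; use D in \<open>simp add: orient_def\<close>)+
  then have "open (O1 \<inter> O2)" by blast
  have "orient v b c = (1 - t) * ?D" "orient a v c = t * ?D"
    unfolding t(3) orient_def by (simp_all add: algebra_simps)
  then have vO: "v \<in> O1 \<inter> O2" using t01 D by (simp add: O1_def O2_def)
  obtain e where e: "e > 0" "ball v e \<subseteq> O1 \<inter> O2"
    using openE[OF \<open>open (O1 \<inter> O2)\<close> vO] .
  have "orient a b v = 0" unfolding t(3) orient_def by (simp add: algebra_simps)
  then have diff: "orient a b x = (b$1 - a$1) * (x$2 - v$2) - (b$2 - a$2) * (x$1 - v$1)" for x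
    by (simp add: orient_def algebra_simps)
  have "n \<bullet> x - n \<bullet> v = d * orient a b x" for x
    unfolding diff n_def by (simp add: inner_real2 algebra_simps)
  then have "n \<bullet> x - n \<bullet> v = - (orient a b x / ?D)" for x
    by (simp add: d_def)
  then have side: "n \<bullet> x \<le> n \<bullet> v \<longleftrightarrow> orient a b x / ?D \<ge> 0" for x
    by (metis diff_le_0_iff_le neg_le_0_iff_le)
  have "a \<noteq> b" using D by (auto simp: orient_def)
  then have "n \<noteq> 0" using D by (auto simp: n_def d_def vec_eq_iff forall_2)
  moreover have "convex hull {a, b, c} \<inter> ball v e = {x. n \<bullet> x \<le> n \<bullet> v} \<inter> ball v e"
  proof (rule set_eqI)
    fix x
    show "x \<in> convex hull {a, b, c} \<inter> ball v e \<longleftrightarrow> x \<in> {x. n \<bullet> x \<le> n \<bullet> v} \<inter> ball v e"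
    proof (cases "x \<in> ball v e")
      case True
      then have "x \<in> O1 \<inter> O2" using e(2) by blast
      then have "orient x b c / ?D \<ge> 0" "orient a x c / ?D \<ge> 0"
        unfolding O1_def O2_def by simp_all
      then show ?thesis unfolding triangle_eq_orient[OF D] side using True by simp
    qed simp
  qed
  ultimately show ?thesis using e(1) by blast
qed

text \<open>The frontier consists of the three sides, and rotating the names of the corners reduces
  each side to the previous lemma.\<close>

lemma region_vertices_triangle:
  assumes D: "orient a b c \<noteq> 0"
  shows "region_vertices (convex hull {a, b, c}) \<subseteq> {a, b, c}"
proof (rule subsetI, rule ccontr)
  fix v assume v: "v \<in> region_vertices (convex hull {a, b, c})" "v \<notin> {a, b, c}"
  have "v \<in> frontier (convex hull {a, b, c})" using v(1) by (simp add: region_vertices_def)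
  also have "frontier (convex hull {a, b, c}) =
      closed_segment a b \<union> closed_segment b c \<union> closed_segment c a"
    by (rule frontier_of_triangle) simp
  finally consider "v \<in> closed_segment a b" | "v \<in> closed_segment b c" | "v \<in> closed_segment c a" by blast
  then have "\<exists>n e. n \<noteq> 0 \<and> e > 0 \<and> convex hull {a, b, c} \<inter> ball v e = {x. n \<bullet> x \<le> n \<bullet> v} \<inter> ball v e"
  proof cases
    case 1
    then show ?thesis using triangle_halfplane_near_side[OF D] v(2) by simp
  next
    case 2
    have "orient b c a \<noteq> 0" using D by (simp add: orient_rotate[symmetric])
    moreover have "{a, b, c} = {b, c, a}" by auto
    ultimately show ?thesis using triangle_halfplane_near_side[of b c a v] 2 v(2) by simp
  next
    case 3
    have "orient c a b \<noteq> 0" using D by (simp add: orient_rotate[symmetric])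
    moreover have "{a, b, c} = {c, a, b}" by auto
    ultimately show ?thesis using triangle_halfplane_near_side[of c a b v] 3 v(2) by simp
  qed
  moreover have "\<not> (\<exists>n e. n \<noteq> 0 \<and> e > 0 \<and> convex hull {a, b, c} \<inter> ball v e = {x. n \<bullet> x \<le> n \<bullet> v} \<inter> ball v e)"
    using v(1) unfolding region_vertices_def mem_Collect_eq by (rule conjunct2)
  ultimately show False by (rule notE[rotated])
qed

lemma polygonal_region_triangle:
  assumes "\<not> collinear {a, b, c :: real^2}"
  shows "polygonal_region (convex hull {a, b, c})"
proof -
  have ne: "a \<noteq> b" "a \<noteq> c" "b \<noteq> c" and "\<not> affine_dependent {a, b, c}"
    using assms by (auto simp: collinear_3_eq_affine_dependent)
  moreover have "card {a, b, c} = Suc (DIM(real^2))" using ne by simp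
  ultimately have "interior (convex hull {a, b, c}) \<noteq> {}"
    by (simp only: interior_convex_hull_eq_empty not_False_eq_True)
  moreover have "polytope (convex hull {a, b, c})" 
    unfolding polytope_def by (intro exI[of _ "{a, b, c}"]) simp
  moreover have "convex hull {a, b, c} \<noteq> {}" by simp
  moreover have "connected (convex hull {a, b, c})" by (simp add: convex_connected)
  ultimately show ?thesis
    unfolding polygonal_region_def by (intro conjI exI[of _ "{convex hull {a, b, c}}"]) simp_all
qed

section \<open>Blocking one non-edge by a small generic triangle\<close>

lemma orient_convex_comb:
  "orient a b ((1 - s) *\<^sub>R x + s *\<^sub>R y) = (1 - s) * orient a b x + s * orient a b y"
  by (simp add: orient_def algebra_simps)

text \<open>By general position every other segment has an endpoint off the line through
  \<open>p a\<close> and \<open>p b\<close>, so it meets that line at most once. Finitely many such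
  points cannot fill an open segment.\<close>

lemma exists_point_on_segment_avoiding:
  assumes gp: "general_position (p ` V)" and inj: "inj_on p V" and fin: "finite V"
    and ab: "a \<in> V" "b \<in> V" "a \<noteq> b"
  obtains z where "z \<in> open_segment (p a) (p b)"
    "\<forall>c\<in>V. \<forall>d\<in>V. c \<noteq> d \<longrightarrow> {c, d} \<noteq> {a, b} \<longrightarrow> z \<notin> closed_segment (p c) (p d)"
proof -
  define f where "f = orient (p a) (p b)"
  define L where "L c d = {x \<in> closed_segment (p c) (p d). f x = 0}" for c d
  have neq: "p a \<noteq> p b" using ab inj by (simp add: inj_on_eq_iff)
  have fnz: "f (p c) \<noteq> 0" if "c \<in> V" "c \<notin> {a, b}" for c
  proof -
    have "a \<noteq> c" "b \<noteq> c" using that(2) by auto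
    then show ?thesis unfolding f_def using that(1) ab
      by (intro general_position_orient_nonzero[OF gp]) (simp_all add: inj_on_eq_iff[OF inj])
  qed
  have finL: "finite (L c d)" if "f (p c) \<noteq> 0" for c d
  proof (rule finite_subset)
    show "L c d \<subseteq> {(1 - f (p c) / (f (p c) - f (p d))) *\<^sub>R p c + (f (p c) / (f (p c) - f (p d))) *\<^sub>R p d}"
    proof
      fix x assume "x \<in> L c d"
      then obtain s where s: "x = (1 - s) *\<^sub>R p c + s *\<^sub>R p d" "f x = 0"
        by (auto simp: L_def in_segment)
      have 0: "(1 - s) * f (p c) + s * f (p d) = 0"
        using s orient_convex_comb[of "p a" "p b" s "p c" "p d"] by (simp add: f_def)
      then have 1: "s * (f (p c) - f (p d)) = f (p c)" by (simp add: algebra_simps)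
      have "f (p c) - f (p d) \<noteq> 0"
      proof
        assume "f (p c) - f (p d) = 0"
        with 1 that show False by simp
      qed
      then have "s = f (p c) / (f (p c) - f (p d))" using 1 by (rule nonzero_eq_divide_eq[THEN iffD2])
      with s(1) show "x \<in> {(1 - f (p c) / (f (p c) - f (p d))) *\<^sub>R p c + (f (p c) / (f (p c) - f (p d))) *\<^sub>R p d}"
        by simp
    qed
  qed simp
  have finL2: "finite (L c d)" if "c \<in> V" "d \<in> V" "c \<noteq> d" "{c, d} \<noteq> {a, b}" for c d
  proof (cases "c \<in> {a, b}")
    case False
    then show ?thesis using that by (intro finL fnz)
  next
    case True
    \<comment> \<open>The pair differs from \<open>{a, b}\<close>, so the other endpoint is off the
      line and the roles are swapped.\<close>
    then have "d \<notin> {a, b}" using that(3,4) by auto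
    then have "finite (L d c)" using that by (intro finL fnz)
    then show ?thesis unfolding L_def closed_segment_commute[of "p d" "p c"] .
  qed
  define Q where "Q = {(c, d) \<in> V \<times> V. c \<noteq> d \<and> {c, d} \<noteq> {a, b}}"
  have "finite Q" unfolding Q_def by (rule finite_subset[of _ "V \<times> V"]) (auto simp: fin)
  then have finU: "finite (\<Union>(c, d)\<in>Q. L c d)"
  proof (rule finite_UN_I)
    fix x assume "x \<in> Q"
    then show "finite (case x of (c, d) \<Rightarrow> L c d)"
      using finL2[of "fst x" "snd x"] by (simp add: Q_def case_prod_beta)
  qed
  have "infinite (open_segment (p a) (p b))" using neq by (simp add: finite_open_segment)
  then have "\<not> open_segment (p a) (p b) \<subseteq> (\<Union>(c, d)\<in>Q. L c d)"
    using finite_subset[of "open_segment (p a) (p b)", OF _ finU] by (rule contrapos_nn)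
  then obtain z where z: "z \<in> open_segment (p a) (p b)" "z \<notin> (\<Union>(c, d)\<in>Q. L c d)"
    by (meson subsetI)
  obtain t where "z = (1 - t) *\<^sub>R p a + t *\<^sub>R p b" using z(1) by (auto simp: in_segment)
  then have "f z = 0"
    using orient_convex_comb[of "p a" "p b" t "p a" "p b"] by (simp add: f_def orient_def)
  show thesis
  proof (rule that[OF z(1)], intro ballI impI notI)
    fix c d assume h: "c \<in> V" "d \<in> V" "c \<noteq> d" "{c, d} \<noteq> {a, b}" "z \<in> closed_segment (p c) (p d)"
    then have "z \<in> L c d" "(c, d) \<in> Q" using \<open>f z = 0\<close> by (simp_all add: L_def Q_def)
    then have "z \<in> (\<Union>(c, d)\<in>Q. L c d)" by (intro UN_I[of "(c, d)"]) simp_all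
    with z(2) show False by (rule notE)
  qed
qed

text \<open>The two bounds are the distances from \<open>q\<close> to the endpoints, so a point of
  the line this close to \<open>q\<close> cannot have passed either end.\<close>

lemma line_near_segment_point:
  fixes A B :: "'a::euclidean_space"
  assumes "q = (1 - t) *\<^sub>R A + t *\<^sub>R B" "x \<in> affine hull {A, B}"
    and "dist q x < t * dist A B" "dist q x < (1 - t) * dist A B"
  shows "x \<in> closed_segment A B"
proof -
  obtain u s where s: "x = u *\<^sub>R A + s *\<^sub>R B" "u + s = 1"
    using assms(2) unfolding affine_hull_2 by blast
  have u: "u = 1 - s" using s(2) by simp
  have "q - x = (s - t) *\<^sub>R (A - B)"
    unfolding assms(1) s(1) u by (simp add: algebra_simps)
  then have d: "dist q x = \<bar>s - t\<bar> * dist A B" by (simp add: dist_norm)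
  have "dist A B > 0" using assms(3) by (cases "A = B") auto
  then have "\<bar>s - t\<bar> < t" "\<bar>s - t\<bar> < 1 - t" using assms(3,4) d by simp_all
  then have "0 \<le> s" "s \<le> 1" by linarith+
  then show ?thesis using s(1) u by (auto simp: in_segment)
qed

text \<open>Take a triangle near \<open>q\<close> with corners on both sides of the line
  \<open>A B\<close>: one of its sides crosses this line close to \<open>q\<close>, hence inside the
  segment. The corners are picked one by one, each generic with respect to all earlier
  points.\<close>

lemma exists_small_obstacle:
  assumes W: "finite W" "general_position W" and AB: "A \<noteq> B"
    and q: "q \<in> open_segment A B" and K: "closed K" "q \<notin> K"
  obtains R W' where "polygonal_region R" "finite W'" "W \<subseteq> W'" "general_position W'"
    "region_vertices R \<subseteq> W'" "R \<inter> closed_segment A B \<noteq> {}" "R \<inter> K = {}"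
proof -
  obtain t where t: "0 < t" "t < 1" "q = (1 - t) *\<^sub>R A + t *\<^sub>R B" using q by (auto simp: in_segment)
  have "open (- K)" "q \<in> - K" using K by auto
  then obtain e0 where e0: "e0 > 0" "ball q e0 \<subseteq> - K" by (rule openE)
  \<comment> \<open>Within this radius the ball misses \<open>K\<close>, and the line through
    \<open>A\<close> and \<open>B\<close> stays inside the segment.\<close>
  define e where "e = min e0 (min (t * dist A B) ((1 - t) * dist A B))"
  have e: "e > 0" using e0 t AB by (simp add: e_def)
  have eK: "ball q e \<inter> K = {}"
  proof -
    have "ball q e \<subseteq> ball q e0" by (rule subset_ball) (simp add: e_def)
    with e0(2) show ?thesis by blast
  qed
  define f where "f = orient A B"
  define w :: "real^2" where "w = vector [- (B$2 - A$2), B$1 - A$1]"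
  have w: "w \<noteq> 0" using AB by (auto simp: w_def vec_eq_iff forall_2)
  have fw: "f (q + s *\<^sub>R w) = s * (w \<bullet> w)" for s
    unfolding f_def t(3) orient_def w_def by (simp add: inner_real2 algebra_simps)
  define s where "s = e / (2 * norm w)"
  have s: "s > 0" using e w by (simp add: s_def)
  have sw: "norm (s *\<^sub>R w) < e" using e w by (simp add: s_def)
  have cont: "continuous_on UNIV f" unfolding f_def orient_def by (intro continuous_intros)
  have op: "open {x. f x > 0}" "open {x. f x < 0}"
    by (rule open_Collect_less[OF continuous_on_const cont], rule open_Collect_less[OF cont continuous_on_const])
  have o1: "open (ball q e \<inter> {x. f x > 0})" and o2: "open (ball q e \<inter> {x. f x < 0})"
    by (rule open_Int[OF open_ball op(1)], rule open_Int[OF open_ball op(2)])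
  \<comment> \<open>\<open>w\<close> is normal to the line \<open>A B\<close>, so moving both ways
    along it shows that the two open half-discs are nonempty.\<close>
  have "q + s *\<^sub>R w \<in> ball q e \<inter> {x. f x > 0}" "q + (- s) *\<^sub>R w \<in> ball q e \<inter> {x. f x < 0}"
    using sw s w unfolding Int_iff mem_Collect_eq fw by (simp_all add: dist_norm)
  then have n1: "ball q e \<inter> {x. f x > 0} \<noteq> {}" and n2: "ball q e \<inter> {x. f x < 0} \<noteq> {}" by blast+
  obtain c1 where c1: "c1 \<in> ball q e \<inter> {x. f x > 0}" "c1 \<notin> W" "general_position (insert c1 W)"
    by (rule general_position_generic_insert[OF W o1 n1])
  define W1 where "W1 = insert c1 W"
  have W1: "finite W1" "general_position W1" using W c1 by (simp_all add: W1_def)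
  obtain c2 where c2: "c2 \<in> ball q e \<inter> {x. f x < 0}" "c2 \<notin> W1" "general_position (insert c2 W1)"
    by (rule general_position_generic_insert[OF W1 o2 n2])
  define W2 where "W2 = insert c2 W1"
  have W2: "finite W2" "general_position W2" using W1 c2 by (simp_all add: W2_def)
  have "ball q e \<noteq> {}" using e by simp
  then obtain c3 where c3: "c3 \<in> ball q e" "c3 \<notin> W2" "general_position (insert c3 W2)"
    by (rule general_position_generic_insert[OF W2 open_ball])
  define W3 where "W3 = insert c3 W2"
  have W3: "finite W3" "general_position W3" using W2 c3 by (simp_all add: W3_def)
  have sub: "{c1, c2, c3} \<subseteq> W3" "W \<subseteq> W3" by (auto simp: W1_def W2_def W3_def)
  have dis: "c1 \<noteq> c2" "c2 \<noteq> c3" "c1 \<noteq> c3" using c2(2) c3(2) by (auto simp: W1_def W2_def)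
  define R where "R = convex hull {c1, c2, c3}"
  have "\<not> collinear {c1, c2, c3}"
    using W3(2) sub(1) dis unfolding general_position_def by simp
  then have R1: "polygonal_region R" unfolding R_def by (rule polygonal_region_triangle)
  have "orient c1 c2 c3 \<noteq> 0"
    using sub(1) dis by (intro general_position_orient_nonzero[OF W3(2)]) auto
  then have R2: "region_vertices R \<subseteq> W3"
    unfolding R_def using order_trans[OF region_vertices_triangle sub(1)] by simp
  have Rb: "R \<subseteq> ball q e"
    unfolding R_def using c1(1) c2(1) c3(1) by (intro hull_minimal) simp_all
  \<comment> \<open>The parameter at which \<open>f\<close>, being affine, vanishes between
    \<open>c1\<close> and \<open>c2\<close>.\<close>
  define r where "r = f c1 / (f c1 - f c2)"
  define x where "x = (1 - r) *\<^sub>R c1 + r *\<^sub>R c2"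
  have f12: "f c1 > 0" "f c2 < 0" using c1(1) c2(1) by auto
  have r: "0 \<le> r" "r \<le> 1" using f12 by (simp_all add: r_def)
  have "f x = (1 - r) * f c1 + r * f c2" unfolding x_def f_def by (rule orient_convex_comb)
  also have "\<dots> = f c1 - r * (f c1 - f c2)" by (simp add: algebra_simps)
  also have "\<dots> = 0" using f12 by (simp add: r_def)
  finally have "collinear {A, B, x}" unfolding f_def by (rule orient_zero_collinear)
  then have xl: "x \<in> affine hull {A, B}" using AB by (simp add: collinear_3_affine_hull)
  have "x \<in> closed_segment c1 c2" using r by (auto simp: x_def in_segment)
  moreover have "closed_segment c1 c2 \<subseteq> R"
    unfolding R_def segment_convex_hull by (rule hull_mono) auto
  ultimately have xR: "x \<in> R" by blast
  then have "dist q x < e" using Rb by auto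
  then have "dist q x < t * dist A B" "dist q x < (1 - t) * dist A B" by (simp_all add: e_def)
  then have "x \<in> closed_segment A B" by (rule line_near_segment_point[OF t(3) xl])
  with xR have R3: "R \<inter> closed_segment A B \<noteq> {}" unfolding disjoint_iff by metis
  have R4: "R \<inter> K = {}" using Rb eK by blast
  show thesis using that[OF R1 W3(1) sub(2) W3(2) R2 R3 R4] .
qed

text \<open>Induction over the non-edges. \<open>W\<close> collects the drawn points and a finite
  set containing all obstacle vertices so far, so that the next triangle can be generic to
  everything; that triangle avoids all other segments and changes nothing for them.\<close>

lemma exists_obstacles_blocking:
  fixes p :: "'a \<Rightarrow> real^2"
  assumes gp: "general_position (p ` V)" and inj: "inj_on p V" and fin: "finite V"
    and "finite \<N>" "\<N> \<subseteq> pairs V"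
  shows "\<exists>Obs W. finite Obs \<and> finite W \<and> p ` V \<subseteq> W \<and> general_position W \<and>
    (\<forall>R\<in>Obs. polygonal_region R \<and> region_vertices R \<subseteq> W) \<and>
    (\<forall>u\<in>V. \<forall>v\<in>V. u \<noteq> v \<longrightarrow>
      ({u, v} \<notin> \<N> \<longleftrightarrow> (\<forall>R\<in>Obs. closed_segment (p u) (p v) \<inter> R = {})))"
  using assms(4,5)
proof (induction \<N> rule: finite_induct)
  case empty
  show ?case
    by (rule exI[of _ "{}"], rule exI[of _ "p ` V"]) (simp add: fin gp)
next
  case (insert e \<N>)
  then obtain Obs W where IH: "finite Obs" "finite W" "p ` V \<subseteq> W" "general_position W"
    "\<And>R. R \<in> Obs \<Longrightarrow> polygonal_region R \<and> region_vertices R \<subseteq> W"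
    "\<And>u v. u \<in> V \<Longrightarrow> v \<in> V \<Longrightarrow> u \<noteq> v \<Longrightarrow>
      {u, v} \<notin> \<N> \<longleftrightarrow> (\<forall>R\<in>Obs. closed_segment (p u) (p v) \<inter> R = {})"
    by auto
  have "e \<in> pairs V" using insert.prems by simp
  then obtain a b where ab: "e = {a, b}" "a \<noteq> b" "a \<in> V" "b \<in> V"
    by (auto simp: pairs_def card_2_iff)
  obtain z where z: "z \<in> open_segment (p a) (p b)"
    "\<forall>c\<in>V. \<forall>d\<in>V. c \<noteq> d \<longrightarrow> {c, d} \<noteq> {a, b} \<longrightarrow> z \<notin> closed_segment (p c) (p d)"
    by (rule exists_point_on_segment_avoiding[OF gp inj fin ab(3,4,2)])
  define Q where "Q = {(c, d) \<in> V \<times> V. c \<noteq> d \<and> {c, d} \<noteq> {a, b}}"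
  define K where "K = (\<Union>(c, d)\<in>Q. closed_segment (p c) (p d))"
  have "finite Q" unfolding Q_def by (rule finite_subset[of _ "V \<times> V"]) (auto simp: fin)
  then have "closed K" unfolding K_def by (rule closed_UN) (simp add: case_prod_beta)
  have "z \<notin> K"
  proof
    assume "z \<in> K"
    then obtain c d where "(c, d) \<in> Q" "z \<in> closed_segment (p c) (p d)" unfolding K_def by fast
    with z(2) show False by (simp add: Q_def)
  qed
  have "p a \<noteq> p b" using ab by (simp add: inj_on_eq_iff[OF inj])
  obtain R W' where R: "polygonal_region R" "finite W'" "W \<subseteq> W'" "general_position W'"
    "region_vertices R \<subseteq> W'" "R \<inter> closed_segment (p a) (p b) \<noteq> {}" "R \<inter> K = {}"
    by (rule exists_small_obstacle[OF IH(2,4) \<open>p a \<noteq> p b\<close> z(1) \<open>closed K\<close> \<open>z \<notin> K\<close>])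
  have block: "{u, v} \<notin> insert e \<N> \<longleftrightarrow> (\<forall>R\<in>insert R Obs. closed_segment (p u) (p v) \<inter> R = {})"
    if uv: "u \<in> V" "v \<in> V" "u \<noteq> v" for u v
  proof (cases "{u, v} = {a, b}")
    case True
    then have eq: "closed_segment (p u) (p v) = closed_segment (p a) (p b)"
      by (auto simp: doubleton_eq_iff closed_segment_commute)
    have "closed_segment (p u) (p v) \<inter> R \<noteq> {}" unfolding eq using R(6) by (subst Int_commute)
    with True ab(1) show ?thesis by simp
  next
    case False
    then have "(u, v) \<in> Q" using uv by (simp add: Q_def)
    then have "closed_segment (p u) (p v) \<subseteq> K" unfolding K_def 
      by (intro SUP_upper2[of "(u, v)"]) simp_all
    then have "closed_segment (p u) (p v) \<inter> R = {}" using R(7) by blast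
    then show ?thesis using IH(6)[OF uv] False ab(1) by simp
  qed
  have "\<forall>R'\<in>insert R Obs. polygonal_region R' \<and> region_vertices R' \<subseteq> W'"
    using IH(5) R(1,3,5) by blast
  moreover have "finite (insert R Obs)" "p ` V \<subseteq> W'" using IH(1,3) R(3) by auto
  ultimately show ?case using R(2,4) block
    by (intro exI[of _ "insert R Obs"] exI[of _ W'] conjI) simp_all
qed

lemma exists_obstacle_representation:
  fixes n :: nat
  obtains p Obs where "obstacle_representation {..<n} E p Obs"
proof -
  obtain p :: "nat \<Rightarrow> real^2" where p: "inj_on p {..<n}" "general_position (p ` {..<n})"
    by (rule exists_general_position)
  have "finite (pairs {..<n} - E)" "pairs {..<n} - E \<subseteq> pairs {..<n}"
    by (auto simp: finite_pairs)
  from exists_obstacles_blocking[OF p(2,1) finite_lessThan this]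
  obtain Obs W where O: "finite Obs" "p ` {..<n} \<subseteq> W" "general_position W"
    "\<forall>R\<in>Obs. polygonal_region R \<and> region_vertices R \<subseteq> W"
    "\<forall>u\<in>{..<n}. \<forall>v\<in>{..<n}. u \<noteq> v \<longrightarrow>
      ({u, v} \<notin> pairs {..<n} - E \<longleftrightarrow> (\<forall>R\<in>Obs. closed_segment (p u) (p v) \<inter> R = {}))"
    by (elim exE conjE)
  have "general_position (p ` {..<n} \<union> (\<Union>R\<in>Obs. region_vertices R))"
    using O(2,4) by (intro general_position_subset[OF O(3)]) blast
  moreover have "{u, v} \<in> E \<longleftrightarrow> {u, v} \<notin> pairs {..<n} - E" if "u \<in> {..<n}" "v \<in> {..<n}" "u \<noteq> v" for u v
    using that by (simp add: pairs_def)
  ultimately have "obstacle_representation {..<n} E p Obs"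
    unfolding obstacle_representation_def using p(1) O(1,4,5) by simp
  then show thesis by (rule that)
qed

subsection \<open>Many disjoint obstacles\<close>

text \<open>In the drawing of the pattern copy some non-edge is covered by clique triangles. An
  obstacle blocking it meets their union and cannot cross their sides, which are edges.\<close>

lemma obstacle_in_pattern_hull:
  assumes rep: "obstacle_representation V E p Obs"
    and U: "\<forall>q. inj_on q {..<m} \<longrightarrow> general_position (q ` {..<m}) \<longrightarrow>
      (\<exists>u v \<T>. cliques_cover_nonedge m adj q u v \<T>)"
    and s: "inj_on s {..<k}" "s ` {..<k} \<subseteq> V" and pat: "contains_pattern E m adj k s"
  shows "\<exists>R\<in>Obs. R \<subseteq> convex hull (p ` s ` {..<k})"
proof -
  from pat obtain \<tau> where \<tau>: "inj_on \<tau> {..<m}" "\<tau> ` {..<m} \<subseteq> {..<k}"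
    "\<And>i j. i < j \<Longrightarrow> j < m \<Longrightarrow> {s (\<tau> i), s (\<tau> j)} \<in> E \<longleftrightarrow> adj i j"
    unfolding contains_pattern_def by blast
  have inj: "inj_on p V" and gp: "general_position (p ` V \<union> (\<Union>R\<in>Obs. region_vertices R))"
    and reg: "\<And>R. R \<in> Obs \<Longrightarrow> polygonal_region R"
    and adjE: "\<And>u v. u \<in> V \<Longrightarrow> v \<in> V \<Longrightarrow> u \<noteq> v \<Longrightarrow>
      {u, v} \<in> E \<longleftrightarrow> (\<forall>R\<in>Obs. closed_segment (p u) (p v) \<inter> R = {})"
    using rep unfolding obstacle_representation_def by simp_all
  define w where "w = s \<circ> \<tau>"
  have winj: "inj_on w {..<m}"
    unfolding w_def by (rule comp_inj_on[OF \<tau>(1) inj_on_subset[OF s(1) \<tau>(2)]])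
  have wk: "w ` {..<m} \<subseteq> s ` {..<k}" unfolding w_def image_comp[symmetric] by (rule image_mono[OF \<tau>(2)])
  have wV: "w ` {..<m} \<subseteq> V" by (rule order_trans[OF wk s(2)])
  have wE: "(\<forall>R\<in>Obs. closed_segment (p (w i)) (p (w j)) \<inter> R = {}) \<longleftrightarrow> adj i j" if "i < j" "j < m" for i j
  proof -
    have "i < m" using that by simp
    then have "w i \<in> V" "w j \<in> V" "w i \<noteq> w j"
      using wV that inj_on_eq_iff[OF winj, of i j] by auto
    from adjE[OF this] show ?thesis using \<tau>(3)[OF that] by (simp add: w_def)
  qed
  define q where "q = p \<circ> w"
  have qinj: "inj_on q {..<m}"
    unfolding q_def by (rule comp_inj_on[OF winj inj_on_subset[OF inj wV]])
  have "q ` {..<m} \<subseteq> p ` V" unfolding q_def image_comp[symmetric] by (rule image_mono[OF wV])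
  then have "general_position (q ` {..<m})"
    by (intro general_position_subset[OF gp]) blast
  from U[rule_format, OF qinj this] obtain u v \<T> where "cliques_cover_nonedge m adj q u v \<T>" by blast
  then have uv: "u < v" "v < m" "\<not> adj u v" and \<T>: "\<T> \<subseteq> Pow {..<m}"
    and clique: "\<And>T. T \<in> \<T> \<Longrightarrow> card T = 2 \<or> card T = 3"
      "\<And>T i j. T \<in> \<T> \<Longrightarrow> i \<in> T \<Longrightarrow> j \<in> T \<Longrightarrow> i < j \<Longrightarrow> adj i j"
    and cover: "closed_segment (q u) (q v) \<subseteq> (\<Union>T\<in>\<T>. convex hull (q ` T))"
    unfolding cliques_cover_nonedge_def by simp_all
  from wE[OF uv(1,2)] uv(3) obtain R where R: "R \<in> Obs" "closed_segment (q u) (q v) \<inter> R \<noteq> {}"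
    unfolding q_def by auto
  have sub: "R \<subseteq> (\<Union>T\<in>\<T>. convex hull (q ` T))"
  proof (rule connected_subset_cliques_union[OF _ clique(1)])
    show "finite \<T>" using \<T> by (rule finite_subset) simp
    show "connected R" using reg[OF R(1)] by (simp add: polygonal_region_def)
    obtain z where "z \<in> closed_segment (q u) (q v)" "z \<in> R" using R(2) by auto
    then have "z \<in> R \<inter> (\<Union>T\<in>\<T>. convex hull (q ` T))" using subsetD[OF cover] by simp
    then show "R \<inter> (\<Union>T\<in>\<T>. convex hull (q ` T)) \<noteq> {}" by (metis empty_iff)
    fix T i j assume T: "T \<in> \<T>" "i \<in> T" "j \<in> T" "i \<noteq> j"
    have lt: "i < m" "j < m" using T \<T> by auto
    show "closed_segment (q i) (q j) \<inter> R = {}"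
    proof (cases "i < j")
      case True
      then show ?thesis using wE[OF True lt(2)] clique(2)[OF T(1-3)] R(1) by (simp add: q_def)
    next
      case False
      then have ji: "j < i" using T(4) by simp
      then have "closed_segment (q j) (q i) \<inter> R = {}"
        using wE[OF ji lt(1)] clique(2)[OF T(1,3,2)] R(1) by (simp add: q_def)
      then show ?thesis by (simp only: closed_segment_commute)
    qed
  qed
  have "(\<Union>T\<in>\<T>. convex hull (q ` T)) \<subseteq> convex hull (p ` s ` {..<k})"
  proof (rule UN_least)
    fix T assume "T \<in> \<T>"
    then have "T \<subseteq> {..<m}" using \<T> by auto
    then have "w ` T \<subseteq> s ` {..<k}" by (rule order_trans[OF image_mono wk])
    then have "q ` T \<subseteq> p ` s ` {..<k}" unfolding q_def image_comp[symmetric] by (rule image_mono)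
    then show "convex hull (q ` T) \<subseteq> convex hull (p ` s ` {..<k})" by (rule hull_mono)
  qed
  with sub R(1) show ?thesis by (meson order_trans)
qed

text \<open>The directions that identify two given points form a hyperplane, and finitely many
  hyperplanes do not cover the space.\<close>

lemma exists_injective_direction:
  fixes p :: "'a \<Rightarrow> 'b::euclidean_space"
  assumes "finite V" "inj_on p V"
  obtains a where "inj_on (\<lambda>u. a \<bullet> p u) V"
proof -
  define Q where "Q = {(u, v) \<in> V \<times> V. u \<noteq> v}"
  define N where "N x = {a. (p (fst x) - p (snd x)) \<bullet> a = 0}" for x
  have "finite Q" unfolding Q_def by (rule finite_subset[of _ "V \<times> V"]) (auto simp: assms(1))
  moreover have "negligible (N x)" if "x \<in> Q" for x
  proof -
    have "p (fst x) - p (snd x) \<noteq> 0"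
      using that inj_onD[OF assms(2), of "fst x" "snd x"] by (auto simp: Q_def)
    then show ?thesis unfolding N_def by (intro negligible_hyperplane disjI1)
  qed
  ultimately have "negligible (\<Union>(N ` Q))" by (intro negligible_Union) auto
  then have "\<Union>(N ` Q) \<noteq> UNIV" by (metis non_negligible_UNIV)
  then obtain a where a: "a \<notin> \<Union>(N ` Q)" by blast
  have "inj_on (\<lambda>u. a \<bullet> p u) V"
  proof (rule inj_onI, rule ccontr)
    fix u v assume h: "u \<in> V" "v \<in> V" "a \<bullet> p u = a \<bullet> p v" "u \<noteq> v"
    then have "(u, v) \<in> Q" "a \<in> N (u, v)"
      by (simp_all add: Q_def N_def inner_diff_left inner_commute[of _ a])
    with a show False by blast
  qed
  then show thesis by (rule that)
qed

lemma exists_sorted_enumeration: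
  fixes h :: "'a \<Rightarrow> real"
  assumes "finite V" "inj_on h V" "card V = n"
  obtains \<sigma> where "bij_betw \<sigma> {..<n} V" "\<And>i j. i < j \<Longrightarrow> j < n \<Longrightarrow> h (\<sigma> i) < h (\<sigma> j)"
proof -
  define ys where "ys = sorted_list_of_set (h ` V)"
  have len: "length ys = n" using assms by (simp add: ys_def card_image)
  have set: "set ys = h ` V" using assms(1) by (simp add: ys_def)
  have "distinct ys" by (simp add: ys_def)
  then have "bij_betw (\<lambda>i. ys ! i) {..<n} (h ` V)"
    using bij_betw_nth[of ys "{..<n}" "h ` V"] len set by simp
  moreover have "bij_betw (inv_into V h) (h ` V) V"
    using assms(2) by (simp add: bij_betw_inv_into inj_on_imp_bij_betw)
  ultimately have "bij_betw (inv_into V h \<circ> (\<lambda>i. ys ! i)) {..<n} V" by (rule bij_betw_trans)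
  moreover have "h ((inv_into V h \<circ> (\<lambda>i. ys ! i)) i) < h ((inv_into V h \<circ> (\<lambda>i. ys ! i)) j)"
    if "i < j" "j < n" for i j
  proof -
    have "i < n" using that by simp
    then have "ys ! i \<in> h ` V" "ys ! j \<in> h ` V" using that len set nth_mem by metis+
    moreover have "ys ! i < ys ! j"
      using sorted_wrt_nth_less[OF strict_sorted_list_of_set[of "h ` V"], of i j] that len
      unfolding ys_def by simp
    ultimately show ?thesis by (simp add: f_inv_into_f)
  qed
  ultimately show thesis by (rule that)
qed

text \<open>Sort the points along a direction separating them and cut the order into blocks of
  \<open>k\<close>. The blocks have convex hulls in disjoint parallel strips, so the obstacles found
  in them are distinct.\<close>

lemma card_obstacles_ge:
  assumes rep: "obstacle_representation V E p Obs" and V: "finite V" "card V = n" and "k > 0"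
    and block: "\<And>s. inj_on s {..<k} \<Longrightarrow> s ` {..<k} \<subseteq> V \<Longrightarrow> \<exists>R\<in>Obs. R \<subseteq> convex hull (p ` s ` {..<k})"
  shows "n div k \<le> card Obs"
proof -
  have inj: "inj_on p V" and fin: "finite Obs" and reg: "\<And>R. R \<in> Obs \<Longrightarrow> polygonal_region R"
    using rep unfolding obstacle_representation_def by simp_all
  obtain a where a: "inj_on (\<lambda>u. a \<bullet> p u) V" by (rule exists_injective_direction[OF V(1) inj])
  obtain \<sigma> where \<sigma>: "bij_betw \<sigma> {..<n} V" "\<And>i j. i < j \<Longrightarrow> j < n \<Longrightarrow> a \<bullet> p (\<sigma> i) < a \<bullet> p (\<sigma> j)"
    using exists_sorted_enumeration[OF V(1) a V(2)] by blast
  have mono: "a \<bullet> p (\<sigma> i) \<le> a \<bullet> p (\<sigma> j)" if "i \<le> j" "j < n" for i j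
    using \<sigma>(2)[of i j] that by (cases "i = j") auto
  define s where "s j i = \<sigma> (j * k + i)" for j i
  have idx: "j * k + i < n" if "j < n div k" "i < k" for j i
  proof -
    have "j * k + i < Suc j * k" using that by simp
    also have "\<dots> \<le> n div k * k" using that by (intro mult_le_mono1) simp
    also have "\<dots> \<le> n" by simp
    finally show ?thesis .
  qed
  have "\<exists>R\<in>Obs. R \<subseteq> convex hull (p ` s j ` {..<k})" if j: "j < n div k" for j
  proof (rule block)
    have inj\<sigma>: "inj_on \<sigma> {..<n}" using \<sigma>(1) by (simp add: bij_betw_def)
    show "inj_on (s j) {..<k}"
    proof (rule inj_onI)
      fix x y assume xy: "x \<in> {..<k}" "y \<in> {..<k}" "s j x = s j y"
      have "j * k + x = j * k + y"
        using xy idx[OF j, of x] idx[OF j, of y] by (intro inj_onD[OF inj\<sigma>]) (simp_all add: s_def)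
      then show "x = y" by simp
    qed
    show "s j ` {..<k} \<subseteq> V"
      using idx[OF j] bij_betw_apply[OF \<sigma>(1)] by (auto simp: s_def)
  qed
  then obtain R where R: "\<And>j. j < n div k \<Longrightarrow> R j \<in> Obs"
    "\<And>j. j < n div k \<Longrightarrow> R j \<subseteq> convex hull (p ` s j ` {..<k})" by metis
  have hi: "a \<bullet> x \<le> a \<bullet> p (\<sigma> (j * k + (k - 1)))" if "j < n div k" "x \<in> R j" for j x
  proof -
    have "convex hull (p ` s j ` {..<k}) \<subseteq> {x. a \<bullet> x \<le> a \<bullet> p (\<sigma> (j * k + (k - 1)))}"
    proof (rule hull_minimal)
      show "p ` s j ` {..<k} \<subseteq> {x. a \<bullet> x \<le> a \<bullet> p (\<sigma> (j * k + (k - 1)))}"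
        using idx[OF that(1), of "k - 1"] \<open>k > 0\<close> by (auto simp: s_def intro!: mono)
    qed (rule convex_halfspace_le)
    then show ?thesis using R(2)[OF that(1)] that(2) by blast
  qed
  have lo: "a \<bullet> x \<ge> a \<bullet> p (\<sigma> (j * k))" if "j < n div k" "x \<in> R j" for j x
  proof -
    have "convex hull (p ` s j ` {..<k}) \<subseteq> {x. a \<bullet> x \<ge> a \<bullet> p (\<sigma> (j * k))}"
    proof (rule hull_minimal)
      show "p ` s j ` {..<k} \<subseteq> {x. a \<bullet> x \<ge> a \<bullet> p (\<sigma> (j * k))}"
        using idx[OF that(1)] by (auto simp: s_def intro!: mono)
    qed (rule convex_halfspace_ge)
    then show ?thesis using R(2)[OF that(1)] that(2) by blast
  qed
  \<comment> \<open>Regions are nonempty, and a point of a shared obstacle would lie both before the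
    end of block \<open>i\<close> and after the start of the later block \<open>j\<close>.\<close>
  have neq: "R i \<noteq> R j" if "i < j" "j < n div k" for i j
  proof
    assume eq: "R i = R j"
    have i: "i < n div k" using that by simp
    have "R i \<noteq> {}" using reg[OF R(1)[OF i]] by (simp add: polygonal_region_def)
    then obtain x where x: "x \<in> R i" by blast
    have "i * k + (k - 1) < Suc i * k" using \<open>k > 0\<close> by simp
    also have "\<dots> \<le> j * k" using that by (intro mult_le_mono1) simp
    finally have "a \<bullet> p (\<sigma> (i * k + (k - 1))) < a \<bullet> p (\<sigma> (j * k))"
      using idx[OF that(2), of 0] \<open>k > 0\<close> by (intro \<sigma>(2)) auto
    with hi[OF i x] lo[OF that(2), of x] x eq show False by simp
  qed
  have "inj_on R {..<n div k}"
  proof (rule inj_onI, rule ccontr)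
    fix i j assume "i \<in> {..<n div k}" "j \<in> {..<n div k}" "R i = R j" "i \<noteq> j"
    then show False using neq[of i j] neq[of j i] by (cases "i < j") auto
  qed
  then have "card {..<n div k} \<le> card Obs"
    using R(1) fin by (intro card_inj_on_le[of R]) auto
  then show ?thesis by simp
qed

text \<open>The existence of a representation is essential here, since \<open>Inf {} = 0\<close>
  would break the bound.\<close>

lemma obstacle_number_ge:
  fixes n :: nat
  assumes "\<And>p Obs. obstacle_representation {..<n} E p Obs \<Longrightarrow> l \<le> card Obs"
  shows "l \<le> obstacle_number {..<n} E"
  unfolding obstacle_number_def
proof (rule cInf_greatest)
  obtain p Obs where "obstacle_representation {..<n} E p Obs" by (rule exists_obstacle_representation)
  then show "{card Obs |p Obs. obstacle_representation {..<n} E p Obs} \<noteq> {}" by blast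
qed (use assms in blast)

text \<open>This serves the small \<open>n\<close> with \<open>n div k = 0\<close>: one non-edge
  already forces an obstacle.\<close>

lemma obstacle_number_empty_graph:
  assumes "n \<ge> 2"
  shows "1 \<le> obstacle_number {..<n::nat} {}"
proof (rule obstacle_number_ge)
  fix p Obs assume rep: "obstacle_representation {..<n} {} p Obs"
  have "(0::nat) \<in> {..<n}" "1 \<in> {..<n}" using assms by auto
  then have "\<exists>R\<in>Obs. closed_segment (p 0) (p 1) \<inter> R \<noteq> {}"
    using rep unfolding obstacle_representation_def by (metis empty_iff zero_neq_one)
  then have "Obs \<noteq> {}" by blast
  moreover have "finite Obs" using rep unfolding obstacle_representation_def by simp
  ultimately show "1 \<le> card Obs" by (simp add: Suc_le_eq card_gt_0_iff)
qed

section \<open>Choice of the parameters and the final bound\<close>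

theorem theorem2:
  "\<exists>c::real. c > 0 \<and>
     (\<forall>n::nat. n \<ge> 2 \<longrightarrow>
        (\<exists>(V::nat set) E. simple_graph V E \<and> card V = n \<and>
           real (obstacle_number V E) \<ge> c * real n / ln (real n)))"
proof -
  obtain m :: nat and adj :: "nat \<Rightarrow> nat \<Rightarrow> bool" where
    U: "\<forall>q. inj_on q {..<m} \<longrightarrow> general_position (q ` {..<m}) \<longrightarrow>
      (\<exists>u v \<T>. cliques_cover_nonedge m adj q u v \<T>)"
    by (rule unavoidable_pattern)
  have "m \<noteq> 0"
  proof
    assume "m = 0"
    with U show False by (simp add: general_position_def cliques_cover_nonedge_def)
  qed
  define x :: real where "x = 1 / 2 ^ (m choose 2)"
  have x: "0 < x" "x \<le> 1" by (simp_all add: x_def)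
  \<comment> \<open>Chosen so that \<open>k \<le> C * ln n\<close> for all \<open>n \<ge> 2\<close>;
    the summand \<open>1 / ln 2\<close> absorbs the rounding of \<open>q\<close>.\<close>
  define C :: real where "C = real (m * m) * (real (m * m) / x + 1 / ln 2)"
  have "real (m * m) > 0" using \<open>m \<noteq> 0\<close> by simp
  then have C: "C > 0" unfolding C_def using x
    by (intro mult_pos_pos add_pos_pos divide_pos_pos) simp_all
  have main: "\<exists>(V::nat set) E. simple_graph V E \<and> card V = n \<and>
      real (obstacle_number V E) \<ge> 1 / (2 * C) * real n / ln (real n)" if n: "n \<ge> 2" for n :: nat
  proof -
    have ln: "ln (real n) > 0" "ln 2 \<le> ln (real n)" using n by simp_all
    define y where "y = real (m * m) * ln (real n) / x"
    have y: "y \<ge> 0" using ln x by (simp add: y_def)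
    \<comment> \<open>The least natural number above \<open>y\<close>, which gives the strict
      inequality demanded by \<open>union_bound_small\<close>.\<close>
    define q where "q = Suc (nat \<lfloor>y\<rfloor>)"
    have q: "q > 0" "y < real q" "real q \<le> y + 1"
      using y by (auto simp: q_def) linarith+
    define k where "k = m * (m * q)"
    have k: "k > 0" using \<open>m \<noteq> 0\<close> q by (simp add: k_def)
    have "y + 1 \<le> (real (m * m) / x + 1 / ln 2) * ln (real n)"
      using ln by (simp add: y_def distrib_right)
    then have "real q \<le> (real (m * m) / x + 1 / ln 2) * ln (real n)" using q(3) by linarith
    then have "real (m * m) * real q \<le> real (m * m) * ((real (m * m) / x + 1 / ln 2) * ln (real n))"
      by (rule mult_left_mono) simp
    then have kC: "real k \<le> C * ln (real n)" by (simp add: k_def C_def mult.assoc)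
    show ?thesis
    proof (cases "n < k")
      case True
      \<comment> \<open>Here \<open>n < k \<le> C * ln n\<close>, so the claimed bound is at most
        1.\<close>
      then have "1 / (2 * C) * real n / ln (real n) \<le> 1"
        using kC C ln by (simp add: divide_simps)
      also have "\<dots> \<le> real (obstacle_number {..<n} {})"
        using obstacle_number_empty_graph[OF n] by simp
      finally have "1 / (2 * C) * real n / ln (real n) \<le> real (obstacle_number {..<n} {})" .
      then show ?thesis
        by (intro exI[of _ "{..<n}"] exI[of _ "{}"]) (simp add: simple_graph_def)
    next
      case False
      have "real (m * m) * ln (real n) < real q * x"
        using q(2) x by (simp add: y_def pos_divide_less_eq)
      then have "real n ^ (m * (m * q)) * (1 - x) ^ (q * q) < 1"
        using n x q by (intro union_bound_small) simp_all
      then obtain E where E: "E \<subseteq> pairs {..<n}"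
        "\<And>s. inj_on s {..<m * (m * q)} \<Longrightarrow> s ` {..<m * (m * q)} \<subseteq> {..<n} \<Longrightarrow>
          contains_pattern E m adj (m * (m * q)) s"
        unfolding x_def by (rule exists_graph_containing_pattern) blast
      have "n div k \<le> obstacle_number {..<n} E"
      proof (rule obstacle_number_ge)
        fix p Obs assume rep: "obstacle_representation {..<n} E p Obs"
        show "n div k \<le> card Obs"
        proof (rule card_obstacles_ge[OF rep finite_lessThan card_lessThan k])
          fix s assume s: "inj_on s {..<k}" "s ` {..<k} \<subseteq> {..<n}"
          have "contains_pattern E m adj k s" using E(2) s unfolding k_def by simp
          then show "\<exists>R\<in>Obs. R \<subseteq> convex hull (p ` s ` {..<k})"
            by (rule obstacle_in_pattern_hull[OF rep U s])
        qed
      qed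
      \<comment> \<open>As \<open>n div k\<close> is at least 1, rounding costs at most a factor 2,
        which explains the 2 in \<open>1 / (2 * C)\<close>.\<close>
      moreover have "n < 2 * (n div k * k)"
      proof -
        have "n < n div k * k + k" using k div_mult_mod_eq[of n k] mod_less_divisor[of k n] by linarith
        moreover have "1 * k \<le> n div k * k"
          using False k by (intro mult_le_mono1) (simp add: Suc_le_eq div_greater_zero_iff)
        ultimately show ?thesis by linarith
      qed
      ultimately have "n < 2 * (obstacle_number {..<n} E * k)"
        by (meson less_le_trans mult_le_mono1 mult_le_mono2)
      then have "real n < real (2 * (obstacle_number {..<n} E * k))" by (simp only: of_nat_less_iff)
      also have "\<dots> = 2 * real (obstacle_number {..<n} E) * real k" by simp
      also have "\<dots> \<le> 2 * real (obstacle_number {..<n} E) * (C * ln (real n))"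
        using kC by (rule mult_left_mono) simp
      finally have "real n \<le> real (obstacle_number {..<n} E) * (2 * C * ln (real n))"
        by (simp add: mult_ac)
      then have "1 / (2 * C) * real n / ln (real n) \<le> real (obstacle_number {..<n} E)"
        using C ln by (simp add: pos_divide_le_eq mult_ac)
      moreover have "simple_graph {..<n} E"
        using E(1) unfolding simple_graph_def pairs_def by blast
      ultimately show ?thesis by (intro exI[of _ "{..<n}"] exI[of _ E]) simp
    qed
  qed
  have "1 / (2 * C) > 0" using C by simp
  with main show ?thesis by blast
qed

end
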